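(* Let $G$ be a countable directed graph such that $\Sigma(G)$ is an irreducible Markov shift with finite Gurevich entropy $h(G)$. For any finite subset $F\subset G$, the semi-local zeta function of $G$ at $F$, $$\zeta^G_F(z):=\exp\sum_{n\ge1}\frac{z^n}{n}\#\{x\in\Sigma(G):\sigma^n(x)=x\text{ and }\{x_0,\dots,x_{n-1}\}\cap F\neq\emptyset\},$$ is holomorphic on $|z|<e^{-h(G)}$ and has a meromorphic extension to $|z|<e^{-h_\infty(G)}$. Moreover, for every $\epsilon>0$, there exists a finite subset $F_0\subset G$ such that, if $F,F'$ are two finite subsets of $G$ both containing $F_0$, then $$\frac{\zeta^G_{F'}(z)}{\zeta^G_F(z)}\ \text{ is holomorphic and non-zero on }\ |z|<e^{-(h_\infty(G)+\epsilon)}.$$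
   Context: For a countable (or finite) directed graph $G$, $\Sigma(G)=\{x\in G^{\mathbb Z}:x_n\to x_{n+1}\text{ on }G\ \forall n\in\mathbb Z\}$ with the left shift $\sigma$ is the Markov shift defined by $G$; it is irreducible when $G$ is strongly connected. Its (Gurevich) entropy $h(G)$ is the supremum of the entropies $h(\sigma,\mu)$ of the shift-invariant probability measures $\mu$ on $\Sigma(G)$; in the irreducible case it equals $\limsup_{n\to\infty}\frac1n\log\#\{v\in G^n:v_1=a,\ v_1\to v_2\to\dots\to v_n=b\}$ for any vertices $a,b$. The entropy at infinity is $$h_\infty(G)=\inf_{F}\ \inf_{\mu_0>0}\ \sup\{h(\sigma,\mu):\mu([F])<\mu_0\},$$ where $F$ ranges over the finite subgraphs of $G$, $[F]=\{x\in\Sigma(G):x_0\in F\}$, and $\mu$ over the shift-invariant probability measures on $\Sigma(G)$, with $\sup\emptyset=-\infty$ (so $h_\infty(G)=-\infty$ if $G$ is finite, and then $e^{-h_\infty(G)}=+\infty$). *)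

theory Defs
  imports
    "Graph_Theory.Pair_Digraph"
    "Graph_Theory.Digraph_Component"
    "HOL-Probability.Information"
    "HOL-Complex_Analysis.Complex_Analysis"
begin

definition left_shift :: "(int \<Rightarrow> 'a) \<Rightarrow> int \<Rightarrow> 'a" where
  "left_shift x = (\<lambda>n. x (n + 1))"

definition markov_shift :: "'a pair_pre_digraph \<Rightarrow> (int \<Rightarrow> 'a) set" where
  "markov_shift G = {x. \<forall>n. x n \<in> pverts G \<and> (x n, x (n + 1)) \<in> parcs G}"

text \<open>For a countable vertex set, the product of the discrete sigma-algebras used here is the
  Borel sigma-algebra of the product of the discrete topologies.\<close>

definition markov_space :: "'a pair_pre_digraph \<Rightarrow> (int \<Rightarrow> 'a) measure" where
  "markov_space G =
     restrict_space (Pi\<^sub>M UNIV (\<lambda>_. count_space (pverts G))) (markov_shift G)"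

definition invariant_measures :: "'a pair_pre_digraph \<Rightarrow> (int \<Rightarrow> 'a) measure set" where
  "invariant_measures G =
     {\<mu>. prob_space \<mu> \<and> sets \<mu> = sets (markov_space G) \<and>
         left_shift \<in> \<mu> \<rightarrow>\<^sub>M \<mu> \<and> distr \<mu> \<mu> left_shift = \<mu>}"

text \<open>Kolmogorov--Sinai entropy. A finite measurable partition is given by a simple function
  \<open>\<xi>\<close> labelling its atoms; the join of its preimages under the first \<open>n\<close> iterates of \<open>T\<close> is then
  the partition given by the length \<open>n\<close> itinerary. \<open>prob_space.entropy\<close> with base \<open>exp 1\<close> and a
  counting measure as reference is Shannon entropy with natural logarithm. The upper limit is a
  limit whenever \<open>T\<close> preserves \<open>M\<close>.\<close>

definition itinerary :: "('x \<Rightarrow> 'x) \<Rightarrow> ('x \<Rightarrow> nat) \<Rightarrow> nat \<Rightarrow> 'x \<Rightarrow> nat list" where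
  "itinerary T \<xi> n x = map (\<lambda>k. \<xi> ((T ^^ k) x)) [0..<n]"

definition partition_entropy :: "'x measure \<Rightarrow> ('x \<Rightarrow> 'b) \<Rightarrow> real" where
  "partition_entropy M X = prob_space.entropy M (exp 1) (count_space (X ` space M)) X"

definition ks_entropy :: "'x measure \<Rightarrow> ('x \<Rightarrow> 'x) \<Rightarrow> ereal" where
  "ks_entropy M T =
     (SUP \<xi>\<in>{\<xi>. simple_function M \<xi>}.
        limsup (\<lambda>n. ereal (partition_entropy M (itinerary T \<xi> n) / real n)))"

definition gurevich_entropy :: "'a pair_pre_digraph \<Rightarrow> ereal" where
  "gurevich_entropy G = (SUP \<mu>\<in>invariant_measures G. ks_entropy \<mu> left_shift)"

text \<open>In \<open>ereal\<close> the supremum of the empty set is \<open>-\<infinity>\<close>.\<close>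

definition entropy_at_infinity :: "'a pair_pre_digraph \<Rightarrow> ereal" where
  "entropy_at_infinity G =
     (INF F\<in>{F. pair_fin_digraph F \<and> subgraph (with_proj F) (with_proj G)}.
        INF \<mu>\<^sub>0\<in>{0<..}.
          SUP \<mu>\<in>{\<mu> \<in> invariant_measures G.
                   measure \<mu> {x \<in> markov_shift G. x 0 \<in> pverts F} < \<mu>\<^sub>0}.
            ks_entropy \<mu> left_shift)"

definition exp_ereal :: "ereal \<Rightarrow> ereal" where
  "exp_ereal x =
     (if x = \<infinity> then \<infinity> else if x = -\<infinity> then 0 else ereal (exp (real_of_ereal x)))"

definition periodic_points_meeting ::
    "'a pair_pre_digraph \<Rightarrow> 'a set \<Rightarrow> nat \<Rightarrow> (int \<Rightarrow> 'a) set" where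
  "periodic_points_meeting G F n =
     {x \<in> markov_shift G. (left_shift ^^ n) x = x \<and> x ` {0..<int n} \<inter> F \<noteq> {}}"

text \<open>The series is indexed from \<open>0\<close>, so index \<open>n\<close> carries the term for the period \<open>Suc n\<close>.\<close>

definition semi_local_zeta_term ::
    "'a pair_pre_digraph \<Rightarrow> 'a set \<Rightarrow> complex \<Rightarrow> nat \<Rightarrow> complex" where
  "semi_local_zeta_term G F z n =
     z ^ Suc n / of_nat (Suc n) * of_nat (card (periodic_points_meeting G F (Suc n)))"

definition semi_local_zeta :: "'a pair_pre_digraph \<Rightarrow> 'a set \<Rightarrow> complex \<Rightarrow> complex" where
  "semi_local_zeta G F z = exp (\<Sum>n. semi_local_zeta_term G F z n)"

end

theory Submission
  imports Defs "HOL-Real_Asymp.Real_Asymp"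
begin

text \<open>Let \<open>P\<^sup>S\<close> be the generating functions of the walks from \<open>c\<close> to \<open>d\<close> whose interior avoids \<open>S\<close>.
  Concatenating loops of equal length independently gives invariant measures that turn bounds on
  entropy into bounds on walk counts: every \<open>P\<^sup>S\<close> converges on the disc given by the entropy, and on
  nearly the whole disc given by the entropy at infinity if \<open>S\<close> contains a large finite set. Splitting
  walks at the first visit to a vertex \<open>a\<close> expresses \<open>P\<^sup>S\<close> rationally through the \<open>P\<close> for
  \<open>S \<union> {a}\<close>, so \<open>P\<^sup>S\<close> is meromorphic on the large disc for every finite \<open>S\<close>. Adding \<open>a\<close> to \<open>F\<close>
  multiplies the zeta function by \<open>1 + P\<^sup>F\<close> at \<open>(a, a)\<close>, because the logarithmic derivative of the
  quotient counts cyclic words through \<open>a\<close>. If \<open>F\<close> is already large, these factors have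
  power series logarithms converging on the large disc.\<close>

section \<open>Walks and cyclic words\<close>

text \<open>Entropies are suprema over measures, so one explicit measure of large entropy is enough
  to refute a walk count that is too large. A long walk avoiding \<open>S\<close> is closed by a
  return path whose length does not depend on the walk; only the two ends and this path can meet
  \<open>S\<close>, so the mass on \<open>S\<close> is O(1/m). This is the smallness demanded by the
  entropy at infinity, and it is why avoidance is imposed on interiors only. The obstacle to
  continuation is that the power series see only the small disc of radius \<open>exp (- h)\<close>.
  Formal identities are evaluated there and carried further by the identity theorem, so continuation
  is a statement about germs at 0. No single finite set is known to serve the whole large disc; the
  continuations on smaller discs must be glued. For the quotient, the renewal equation makes 1 + W
  the inverse of 1 - P, where P counts first returns and W all returns to \<open>a\<close>. The
  logarithmic derivative is kept as P'(1 + W) instead of P'/(1 - P): without a division, the radii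
  of P and W bound its radius directly.\<close>

fun chain :: "('a \<times> 'a) set \<Rightarrow> 'a \<Rightarrow> 'a list \<Rightarrow> 'a \<Rightarrow> bool" where
  "chain E c [] d \<longleftrightarrow> (c, d) \<in> E"
| "chain E c (x # xs) d \<longleftrightarrow> (c, x) \<in> E \<and> chain E x xs d"

text \<open>Makes the decompositions at a first visit injective. Applied to reversed lists it does
  the same for last visits.\<close>

lemma split_list_first_unique:
  assumes "a \<notin> set ys" "a \<notin> set ys'"
  shows "ys @ a # zs = ys' @ a # zs' \<longleftrightarrow> ys = ys' \<and> zs = zs'"
  using assms
proof (induction ys arbitrary: ys')
  case Nil then show ?case by (cases ys') auto
next
  case (Cons y ys) then show ?case by (cases ys') auto
qed

lemma chain_append: "chain E c (xs @ y # ys) d \<longleftrightarrow> chain E c xs y \<and> chain E y ys d"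
  by (induction xs arbitrary: c) auto

lemma chain_nth:
  "chain E c xs d \<longleftrightarrow> (\<forall>i<Suc (length xs). ((c # xs) ! i, (xs @ [d]) ! i) \<in> E)"
proof (induction xs arbitrary: c)
  case (Cons x xs)
  show ?case
    unfolding chain.simps Cons.IH by (simp add: All_less_Suc2)
qed simp

text \<open>Words are not taken modulo rotation and may be powers of shorter words: zeta functions
  count fixed points of the n-th iterate of the shift, which have an origin and need not have
  minimal period n.\<close>

definition cyc :: "('a \<times> 'a) set \<Rightarrow> 'a list \<Rightarrow> bool" where
  "cyc E ws \<longleftrightarrow> ws \<noteq> [] \<and> chain E (hd ws) (tl ws) (hd ws)"

lemma cyc_Cons: "cyc E (c # xs) \<longleftrightarrow> chain E c xs c"
  by (simp add: cyc_def)

lemma cyc_append_commute: "cyc E (u @ v) \<longleftrightarrow> cyc E (v @ u)"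
proof (cases "u = [] \<or> v = []")
  case False
  then obtain c xs d ys where "u = c # xs" "v = d # ys"
    by (metis neq_Nil_conv)
  then show ?thesis
    by (auto simp: cyc_Cons chain_append)
qed auto

lemma cyc_nth:
  assumes "ws \<noteq> []"
  shows "cyc E ws \<longleftrightarrow> (\<forall>i<length ws. (ws ! i, ws ! (Suc i mod length ws)) \<in> E)"
proof -
  obtain c xs where ws: "ws = c # xs" using assms by (cases ws) auto
  have "(xs @ [c]) ! i = ws ! (Suc i mod length ws)" if "i < Suc (length xs)" for i
    using that by (cases "i = length xs") (auto simp: ws nth_append)
  then show ?thesis
    by (auto simp: ws cyc_Cons chain_nth)
qed

text \<open>The ends are exempt from avoidance, so that \<open>walks E (insert a S) a a\<close>
  consists of the first-return loops at \<open>a\<close>.\<close>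

definition walks :: "('a \<times> 'a) set \<Rightarrow> 'a set \<Rightarrow> 'a \<Rightarrow> 'a \<Rightarrow> 'a list set" where
  "walks E S c d = {xs. chain E c xs d \<and> set xs \<inter> S = {}}"

section \<open>Generating functions of sets with a size\<close>

text \<open>A walk is recorded by its interior vertices, so its length is one more than that of the list.\<close>

definition counting_fps :: "'b set \<Rightarrow> ('b \<Rightarrow> nat) \<Rightarrow> complex fps" where
  "counting_fps A s = Abs_fps (\<lambda>n. of_nat (card {x \<in> A. s x = n}))"

lemma counting_fps_nth: "fps_nth (counting_fps A s) n = of_nat (card {x \<in> A. s x = n})"
  by (simp add: counting_fps_def)

text \<open>\<open>card\<close> is 0 on infinite sets, so sums and products of counting series are
  right only with finite levels.\<close>

definition finite_levels :: "'b set \<Rightarrow> ('b \<Rightarrow> nat) \<Rightarrow> bool" where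
  "finite_levels A s \<longleftrightarrow> (\<forall>n. finite {x \<in> A. s x = n})"

lemma finite_levels_subset: "finite_levels B s \<Longrightarrow> A \<subseteq> B \<Longrightarrow> finite_levels A s"
proof -
  assume *: "finite_levels B s" "A \<subseteq> B"
  have "{x \<in> A. s x = n} \<subseteq> {x \<in> B. s x = n}" for n using *(2) by auto
  with *(1) show ?thesis unfolding finite_levels_def by (metis finite_subset)
qed

lemma counting_fps_Un:
  assumes "A \<inter> B = {}" "finite_levels A s" "finite_levels B s"
  shows "counting_fps (A \<union> B) s = counting_fps A s + counting_fps B s"
proof (rule fps_ext)
  fix n
  have "{x \<in> A \<union> B. s x = n} = {x \<in> A. s x = n} \<union> {x \<in> B. s x = n}" by auto
  moreover have "{x \<in> A. s x = n} \<inter> {x \<in> B. s x = n} = {}" using assms(1) by auto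
  ultimately show "fps_nth (counting_fps (A \<union> B) s) n = fps_nth (counting_fps A s + counting_fps B s) n"
    using assms(2,3) by (simp add: counting_fps_nth finite_levels_def card_Un_disjoint)
qed

lemma level_image:
  assumes "\<And>x. x \<in> A \<Longrightarrow> t (f x) = s x"
  shows "{y \<in> f ` A. t y = n} = f ` {x \<in> A. s x = n}"
  using assms by auto

lemma counting_fps_image:
  assumes "inj_on f A" "\<And>x. x \<in> A \<Longrightarrow> t (f x) = s x"
  shows "counting_fps (f ` A) t = counting_fps A s"
proof -
  have "card (f ` {x \<in> A. s x = n}) = card {x \<in> A. s x = n}" for n
    by (intro card_image inj_on_subset[OF assms(1)]) auto
  then show ?thesis
    by (intro fps_ext) (simp add: counting_fps_nth level_image[where s = s and t = t and f = f and A = A, OF assms(2)])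
qed

lemma level_Times:
  fixes s :: "'b \<Rightarrow> nat" and t :: "'c \<Rightarrow> nat"
  shows
  "{x \<in> A \<times> B. s (fst x) + t (snd x) = n} =
    (\<Union>i\<in>{0..n}. {x \<in> A. s x = i} \<times> {y \<in> B. t y = n - i})"
  by auto

lemma counting_fps_Times:
  assumes "finite_levels A s" "finite_levels B t"
  shows "counting_fps (A \<times> B) (\<lambda>x. s (fst x) + t (snd x)) = counting_fps A s * counting_fps B t"
proof (rule fps_ext)
  fix n
  have "card (\<Union>i\<in>{0..n}. {x \<in> A. s x = i} \<times> {y \<in> B. t y = n - i}) =
      (\<Sum>i\<in>{0..n}. card ({x \<in> A. s x = i} \<times> {y \<in> B. t y = n - i}))"
    using assms by (intro card_UN_disjoint) (auto simp: finite_levels_def)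
  then show "fps_nth (counting_fps (A \<times> B) (\<lambda>x. s (fst x) + t (snd x))) n = fps_nth (counting_fps A s * counting_fps B t) n"
    by (simp add: counting_fps_nth level_Times fps_mult_nth card_cartesian_product)
qed

lemma finite_levels_Times:
  assumes "finite_levels A s" "finite_levels B t"
  shows "finite_levels (A \<times> B) (\<lambda>x. s (fst x) + t (snd x))"
  using assms by (auto simp: finite_levels_def level_Times)

lemma finite_levels_image:
  assumes "finite_levels A s" "\<And>x. x \<in> A \<Longrightarrow> t (f x) = s x"
  shows "finite_levels (f ` A) t"
  using assms(1) by (simp add: finite_levels_def level_image[where s = s and t = t and f = f and A = A, OF assms(2)])

definition walk_fps :: "('a \<times> 'a) set \<Rightarrow> 'a set \<Rightarrow> 'a \<Rightarrow> 'a \<Rightarrow> complex fps" where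
  "walk_fps E S c d = counting_fps (walks E S c d) (\<lambda>xs. Suc (length xs))"

lemma walk_fps_nth_0 [simp]: "fps_nth (walk_fps E S c d) 0 = 0"
  by (simp add: walk_fps_def counting_fps_nth)

lemma walk_fps_nth_Suc:
  "fps_nth (walk_fps E S c d) (Suc n) = of_nat (card {xs \<in> walks E S c d. length xs = n})"
  by (simp add: walk_fps_def counting_fps_nth)

definition cyc_words :: "('a \<times> 'a) set \<Rightarrow> 'a set \<Rightarrow> 'a \<Rightarrow> 'a list set" where
  "cyc_words E S a = {ws. cyc E ws \<and> set ws \<inter> S = {} \<and> a \<in> set ws}"

text \<open>Infinite degrees are allowed in the graph. For a graph of finite entropy this finiteness
  is derived from the entropy bound.\<close>

locale finite_walks =
  fixes E :: "('a \<times> 'a) set"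
  assumes finite_walks: "finite {xs \<in> walks E {} c d. length xs = n}"
begin

lemma finite_levels_walks: "finite_levels (walks E S c d) (\<lambda>xs. Suc (length xs))"
proof -
  have "finite {xs \<in> walks E {} c d. Suc (length xs) = n}" for n
    using finite_walks[of c d "n - 1"] by (rule rev_finite_subset) auto
  then have "finite_levels (walks E {} c d) (\<lambda>xs. Suc (length xs))"
    by (simp add: finite_levels_def)
  then show ?thesis
    by (rule finite_levels_subset) (auto simp: walks_def)
qed

text \<open>A walk either misses \<open>a\<close> or splits uniquely at its first visit: the part
  before avoids \<open>a\<close>, the part after is only bound to avoid \<open>S\<close>. The
  lengths add up because the vertex \<open>a\<close> between the two interior lists supplies the
  second \<open>Suc\<close>.\<close>

lemma walk_fps_first_visit:
  assumes "a \<notin> S"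
  shows "walk_fps E S c d =
    walk_fps E (insert a S) c d + walk_fps E (insert a S) c a * walk_fps E S a d"
proof -
  let ?s = "\<lambda>xs. Suc (length xs)" and ?f = "\<lambda>(ys, zs). ys @ a # zs"
  let ?T = "walks E (insert a S) c a \<times> walks E S a d"
  let ?t = "\<lambda>x. ?s (fst x) + ?s (snd x)"
  have split: "walks E S c d = walks E (insert a S) c d \<union> ?f ` ?T"
  proof (intro equalityI subsetI)
    fix xs assume xs: "xs \<in> walks E S c d"
    show "xs \<in> walks E (insert a S) c d \<union> ?f ` ?T"
    proof (cases "a \<in> set xs")
      case True
      then obtain ys zs where "xs = ys @ a # zs" "a \<notin> set ys"
        by (meson split_list_first)
      with xs have "(ys, zs) \<in> ?T" "xs = ?f (ys, zs)"
        by (auto simp: walks_def chain_append)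
      then show ?thesis by blast
    qed (use xs in \<open>auto simp: walks_def\<close>)
  qed (use assms in \<open>auto simp: walks_def chain_append\<close>)
  have "inj_on ?f ?T"
    by (auto simp: inj_on_def walks_def split_list_first_unique)
  then have "counting_fps (?f ` ?T) ?s = counting_fps ?T ?t"
    by (intro counting_fps_image) auto
  also have "\<dots> = walk_fps E (insert a S) c a * walk_fps E S a d"
    unfolding walk_fps_def by (intro counting_fps_Times finite_levels_walks)
  finally have prod: "counting_fps (?f ` ?T) ?s = \<dots>" .
  have "finite_levels (?f ` ?T) ?s"
    by (rule finite_levels_subset[OF finite_levels_walks[of S c d]]) (use split in auto)
  moreover have "walks E (insert a S) c d \<inter> ?f ` ?T = {}"
    by (auto simp: walks_def)
  ultimately show ?thesis
    unfolding walk_fps_def[of E S c d] split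
    by (subst counting_fps_Un) (auto simp: finite_levels_walks prod walk_fps_def[of E "insert a S" c d])
qed

text \<open>The operator X d/dX marks a place. A walk of length n has n - 1 interior vertices, hence
  n places where its list can be cut.\<close>

lemma counting_fps_split:
  "counting_fps {p. fst p @ snd p \<in> walks E S c d} (\<lambda>p. Suc (length (fst p @ snd p))) =
    fps_X * fps_deriv (walk_fps E S c d)"
proof (rule fps_ext)
  fix n
  let ?W = "{xs \<in> walks E S c d. Suc (length xs) = n}"
  have "bij_betw (\<lambda>(xs, k). (take k xs, drop k xs)) (?W \<times> {..<n})
      {p \<in> {p. fst p @ snd p \<in> walks E S c d}. Suc (length (fst p @ snd p)) = n}"
    by (rule bij_betwI[where g = "\<lambda>(u, v). (u @ v, length u)"]) auto
  then have eq: "card {p \<in> {p. fst p @ snd p \<in> walks E S c d}. Suc (length (fst p @ snd p)) = n} =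
      n * card ?W"
    by (simp add: bij_betw_same_card[symmetric] card_cartesian_product)
  show "fps_nth (counting_fps {p. fst p @ snd p \<in> walks E S c d} (\<lambda>p. Suc (length (fst p @ snd p)))) n =
      fps_nth (fps_X * fps_deriv (walk_fps E S c d)) n"
    unfolding counting_fps_nth eq by (cases n) (auto simp: counting_fps_nth walk_fps_def algebra_simps)
qed

text \<open>A cyclic word through \<open>a\<close> is read off a first-return loop, cut at the origin of the word,
  followed by an arbitrary number of further returns to \<open>a\<close>.\<close>

lemma counting_fps_cyc_words:
  assumes "a \<notin> S"
  shows "counting_fps (cyc_words E S a) length =
    fps_X * fps_deriv (walk_fps E (insert a S) a a) * (1 + walk_fps E S a a)"
    and "finite_levels (cyc_words E S a) length"
proof -
  let ?P = "{p. fst p @ snd p \<in> walks E (insert a S) a a}"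
  let ?s = "\<lambda>p. Suc (length (fst p @ snd p))"
  \<comment> \<open>In \<open>v @ l @ a # u\<close> the list \<open>v\<close> precedes the first
    visit to \<open>a\<close> and \<open>u\<close> follows the last one. The first-return loop runs
    from the last visit through \<open>u\<close>, across the origin, and through \<open>v\<close> to
    the first visit. The list \<open>l\<close> reaches from the first visit to just before the last;
    it is empty if there is only one visit, which gives the summand 1.\<close>
  let ?L = "{[]} \<union> (#) a ` walks E S a a"
  let ?f = "\<lambda>((u, v), l). v @ l @ a # u"
  have finP: "finite_levels ?P ?s"
    unfolding finite_levels_def
  proof
    fix n
    have "{p \<in> ?P. ?s p = n} \<subseteq>
        (\<lambda>(xs, k). (take k xs, drop k xs)) ` ({xs \<in> walks E (insert a S) a a. Suc (length xs) = n} \<times> {..<n})"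
    proof
      fix p assume p: "p \<in> {p \<in> ?P. ?s p = n}"
      show "p \<in> (\<lambda>(xs, k). (take k xs, drop k xs)) `
          ({xs \<in> walks E (insert a S) a a. Suc (length xs) = n} \<times> {..<n})"
        by (rule image_eqI[of _ _ "(fst p @ snd p, length (fst p))"]) (use p in auto)
    qed
    moreover have "finite ({xs \<in> walks E (insert a S) a a. Suc (length xs) = n} \<times> {..<n})"
      using finite_levels_walks[of "insert a S" a a] by (simp add: finite_levels_def)
    ultimately show "finite {p \<in> ?P. ?s p = n}"
      by (rule finite_subset[OF _ finite_imageI])
  qed
  have fin1: "finite_levels ((#) a ` walks E S a a) length"
    by (rule finite_levels_image[OF finite_levels_walks]) auto
  have "counting_fps ((#) a ` walks E S a a) length = walk_fps E S a a"
    unfolding walk_fps_def by (rule counting_fps_image) auto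
  moreover have "counting_fps {[] :: 'a list} length = 1"
  proof (rule fps_ext)
    fix n
    have "{x. x = [] \<and> length x = n} = (if n = 0 then {[] :: 'a list} else {})" by auto
    then show "fps_nth (counting_fps {[] :: 'a list} length) n = fps_nth 1 n"
      by (simp add: counting_fps_nth)
  qed
  ultimately have gfL: "counting_fps ?L length = 1 + walk_fps E S a a"
    using fin1 by (subst counting_fps_Un) (auto simp: finite_levels_def)
  have finL: "finite_levels ?L length"
    using fin1 unfolding finite_levels_def by (auto simp: Collect_disj_eq conj_disj_distribR)
  have inj: "inj_on ?f (?P \<times> ?L)"
  proof (rule inj_onI)
    fix x y assume "x \<in> ?P \<times> ?L" "y \<in> ?P \<times> ?L" "?f x = ?f y"
    then obtain u v l u' v' l' where xy: "x = ((u, v), l)" "y = ((u', v'), l')"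
      and uv: "u @ v \<in> walks E (insert a S) a a" "u' @ v' \<in> walks E (insert a S) a a"
      and l: "l \<in> ?L" "l' \<in> ?L" and eq: "v @ l @ a # u = v' @ l' @ a # u'"
      by (cases x, cases y) auto
    have a: "a \<notin> set u" "a \<notin> set v" "a \<notin> set u'" "a \<notin> set v'"
      using uv by (auto simp: walks_def)
    \<comment> \<open>Even if \<open>l\<close> is empty, \<open>l @ [a]\<close> begins with
      \<open>a\<close>, so \<open>v\<close> always ends just before the first
      \<open>a\<close>.\<close>
    obtain r r' where r: "l @ [a] = a # r" "l' @ [a] = a # r'"
      using l by fastforce
    have "v @ a # (r @ u) = v' @ a # (r' @ u')"
      using eq r by (metis append.assoc append_Cons append_Nil)
    then have v: "v = v'"
      using a by (simp add: split_list_first_unique)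
    \<comment> \<open>Reversal turns the last \<open>a\<close> into the first.\<close>
    have "rev u @ a # rev (v @ l) = rev u' @ a # rev (v' @ l')"
      using arg_cong[OF eq, of rev] by simp
    then have "rev u = rev u'"
      using a by (subst (asm) split_list_first_unique) auto
    with v eq show "x = y" by (simp add: xy)
  qed
  have image: "cyc_words E S a = ?f ` (?P \<times> ?L)"
  proof (intro equalityI subsetI)
    fix ws assume ws: "ws \<in> cyc_words E S a"
    then obtain v r where v: "ws = v @ a # r" "a \<notin> set v"
      by (auto simp: cyc_words_def dest: split_list_first)
    obtain m u where u: "a # r = m @ a # u" "a \<notin> set u"
      by (metis list.set_intros(1) split_list_last)
    have c: "cyc E (m @ a # u @ v)"
      using ws cyc_append_commute[of E v "m @ a # u"] by (simp add: cyc_words_def v(1) u(1))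
    have S: "set m \<inter> S = {}" "set u \<inter> S = {}" "set v \<inter> S = {}"
      using ws by (auto simp: cyc_words_def v(1) u(1))
    have "((u, v), m) \<in> ?P \<times> ?L"
    proof (cases m)
      case Nil
      then show ?thesis using c S u v by (auto simp: walks_def cyc_Cons)
    next
      case (Cons b m')
      then have "b = a" using u(1) by simp
      then show ?thesis using c S u v Cons by (auto simp: walks_def cyc_Cons chain_append)
    qed
    moreover have "ws = ?f ((u, v), m)" using v u by simp
    ultimately show "ws \<in> ?f ` (?P \<times> ?L)" by blast
  next
    fix ws assume "ws \<in> ?f ` (?P \<times> ?L)"
    then obtain y where y: "y \<in> ?P \<times> ?L" "ws = ?f y" by blast
    obtain u v l where "y = ((u, v), l)" by (metis prod.exhaust)
    with y have *: "u @ v \<in> walks E (insert a S) a a" "l \<in> ?L" "ws = v @ l @ a # u"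
      by auto
    have "cyc E (l @ a # u @ v)"
      using * by (auto simp: walks_def cyc_Cons chain_append)
    then have "cyc E ws"
      using cyc_append_commute[of E v "l @ a # u"] by (simp add: *)
    then show "ws \<in> cyc_words E S a"
      using * assms by (auto simp: cyc_words_def walks_def)
  qed
  let ?t = "\<lambda>x. ?s (fst x) + length (snd x)"
  have len: "length (?f x) = ?t x" for x
    by (cases x) auto
  have "counting_fps (cyc_words E S a) length = counting_fps (?P \<times> ?L) ?t"
    unfolding image by (rule counting_fps_image[where f = ?f and t = length and s = ?t, OF inj len])
  also have "\<dots> = counting_fps ?P ?s * counting_fps ?L length"
    by (rule counting_fps_Times[OF finP finL])
  finally show "counting_fps (cyc_words E S a) length =
      fps_X * fps_deriv (walk_fps E (insert a S) a a) * (1 + walk_fps E S a a)"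
    unfolding counting_fps_split gfL .
  show "finite_levels (cyc_words E S a) length"
    unfolding image by (rule finite_levels_image[where f = ?f and t = length and s = ?t, OF finite_levels_Times[OF finP finL] len])
qed

end

section \<open>Periodic points as cyclic words\<close>

lemma left_shift_funpow: "(left_shift ^^ n) x = (\<lambda>t. x (t + int n))"
  by (induction n) (auto simp: left_shift_def algebra_simps)

lemma periodic_mod:
  assumes "\<And>t. x (t + int n) = x t"
  shows "x t = x (t mod int n)"
proof -
  have nat: "x (t + int n * int k) = x t" for t k
  proof (induction k)
    case (Suc k)
    then show ?case using assms[of "t + int n * int k"] by (simp add: algebra_simps)
  qed simp
  have int: "x (t + int n * k) = x t" for t k
  proof (cases "k \<ge> 0")
    case True then show ?thesis using nat[of t "nat k"] by simp
  next
    case False then show ?thesis using nat[of "t + int n * k" "nat (- k)"] by simp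
  qed
  show ?thesis using int[of "t mod int n" "t div int n"] by (simp add: add.commute)
qed

text \<open>A periodic point is its window at 0, ..., n - 1 repeated; the arc across the window's
  end is the closing arc of the cyclic word. Well-formedness supplies the vertex condition of
  \<open>markov_shift\<close> from the arcs alone.\<close>

lemma bij_betw_periodic_points:
  assumes n: "n > 0" and wf: "pair_wf_digraph G"
  shows "bij_betw (\<lambda>x. map (\<lambda>i. x (int i)) [0..<n]) (periodic_points_meeting G F n)
    {ws. length ws = n \<and> cyc (parcs G) ws \<and> set ws \<inter> F \<noteq> {}}"
proof (rule bij_betwI[where g = "\<lambda>ws t. ws ! nat (t mod int n)"])
  interpret pair_wf_digraph G by fact
  show "(\<lambda>x. map (\<lambda>i. x (int i)) [0..<n]) \<in>
      periodic_points_meeting G F n \<rightarrow> {ws. length ws = n \<and> cyc (parcs G) ws \<and> set ws \<inter> F \<noteq> {}}"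
  proof
    fix x assume x: "x \<in> periodic_points_meeting G F n"
    then have per: "x (t + int n) = x t" for t
      by (metis (mono_tags, lifting) left_shift_funpow mem_Collect_eq periodic_points_meeting_def)
    let ?ws = "map (\<lambda>i. x (int i)) [0..<n]"
    have "(?ws ! i, ?ws ! (Suc i mod length ?ws)) \<in> parcs G" if "i < n" for i
    proof -
      have "(x (int i), x (int i + 1)) \<in> parcs G"
        using x by (auto simp: periodic_points_meeting_def markov_shift_def)
      moreover have "x (int i + 1) = x (int (Suc i mod n))"
        using periodic_mod[of x n, OF per, of "int i + 1"] by (simp add: zmod_int add.commute)
      ultimately show ?thesis using that n by simp
    qed
    then have "cyc (parcs G) ?ws"
      using n by (subst cyc_nth) auto
    moreover have "set ?ws = x ` {0..<int n}"
      by (auto simp: image_iff) (metis atLeastLessThan_iff nonneg_int_cases of_nat_less_iff le0)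
    ultimately show "?ws \<in> {ws. length ws = n \<and> cyc (parcs G) ws \<and> set ws \<inter> F \<noteq> {}}"
      using x by (auto simp: periodic_points_meeting_def)
  qed
  show "(\<lambda>ws t. ws ! nat (t mod int n)) \<in>
      {ws. length ws = n \<and> cyc (parcs G) ws \<and> set ws \<inter> F \<noteq> {}} \<rightarrow> periodic_points_meeting G F n"
  proof
    fix ws assume "ws \<in> {ws. length ws = n \<and> cyc (parcs G) ws \<and> set ws \<inter> F \<noteq> {}}"
    then have ws: "length ws = n" "cyc (parcs G) ws" "set ws \<inter> F \<noteq> {}" by auto
    let ?x = "\<lambda>t. ws ! nat (t mod int n)"
    have arc: "(?x t, ?x (t + 1)) \<in> parcs G" for t
    proof -
      define i where "i = nat (t mod int n)"
      have i: "int i = t mod int n" "i < n" using n by (auto simp: i_def nat_less_iff)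
      have "(t + 1) mod int n = int (Suc i mod n)"
        by (simp add: zmod_int i mod_simps add.commute)
      moreover have "(ws ! i, ws ! (Suc i mod n)) \<in> parcs G"
        using cyc_nth[of ws "parcs G"] ws i n by (cases "ws = []") auto
      ultimately show ?thesis by (simp add: i_def)
    qed
    then have "?x \<in> markov_shift G"
      using in_arcsD1 by (auto simp: markov_shift_def)
    moreover have "(left_shift ^^ n) ?x = ?x"
      by (simp add: left_shift_funpow)
    moreover have "set ws \<subseteq> ?x ` {0..<int n}"
    proof
      fix y assume "y \<in> set ws"
      then obtain i where "i < n" "y = ws ! i" using ws by (auto simp: in_set_conv_nth)
      then show "y \<in> ?x ` {0..<int n}" by (intro image_eqI[of _ _ "int i"]) auto
    qed
    ultimately show "?x \<in> periodic_points_meeting G F n"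
      using ws by (auto simp: periodic_points_meeting_def)
  qed
  show "(\<lambda>t. map (\<lambda>i. x (int i)) [0..<n] ! nat (t mod int n)) = x"
    if "x \<in> periodic_points_meeting G F n" for x
  proof
    fix t
    have per: "x (t + int n) = x t" for t
      using that by (metis (mono_tags, lifting) left_shift_funpow mem_Collect_eq periodic_points_meeting_def)
    have "nat (t mod int n) < n" using n by (simp add: nat_less_iff)
    then show "map (\<lambda>i. x (int i)) [0..<n] ! nat (t mod int n) = x t"
      using n periodic_mod[of x n, OF per, of t] by simp
  qed
  show "map (\<lambda>i. ws ! nat (int i mod int n)) [0..<n] = ws"
    if "ws \<in> {ws. length ws = n \<and> cyc (parcs G) ws \<and> set ws \<inter> F \<noteq> {}}" for ws
    using that by (intro nth_equalityI) auto
qed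

section \<open>Random concatenation of loops\<close>

text \<open>Entropy is the mean of -ln of the probability of an atom, and every such value is at
  least -ln p.\<close>

lemma (in prob_space) partition_entropy_ge:
  assumes X: "simple_function M X" and p: "p > 0"
    and le: "\<And>s. prob (X -` {s} \<inter> space M) \<le> p"
  shows "partition_entropy M X \<ge> - ln p"
proof -
  interpret information_space M "exp 1" by standard simp
  define f where "f s = prob (X -` {s} \<inter> space M)" for s
  have "simple_distributed M X f"
    by (rule simple_distributedI[OF X]) (auto simp: f_def)
  then have eq: "partition_entropy M X = - (\<Sum>s\<in>X ` space M. f s * log (exp 1) (f s))"
    unfolding partition_entropy_def by (rule entropy_simple_distributed)
  have fin: "finite (X ` space M)" using X by (rule simple_functionD)
  have "(\<Sum>s\<in>X ` space M. f s) = prob (\<Union>s\<in>X ` space M. X -` {s} \<inter> space M)"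
    unfolding f_def using fin X
    by (intro finite_measure_finite_Union[symmetric])
       (auto simp: disjoint_family_on_def simple_functionD)
  also have "(\<Union>s\<in>X ` space M. X -` {s} \<inter> space M) = space M" by auto
  finally have sum: "(\<Sum>s\<in>X ` space M. f s) = 1" by (simp add: prob_space)
  have "f s * log (exp 1) (f s) \<le> f s * ln p" for s
  proof (cases "f s = 0")
    case False
    then have "f s > 0" by (simp add: f_def zero_less_measure_iff)
    then show ?thesis using le[of s] p
      by (intro mult_left_mono) (auto simp: log_def f_def)
  qed simp
  then have "(\<Sum>s\<in>X ` space M. f s * log (exp 1) (f s)) \<le> (\<Sum>s\<in>X ` space M. f s * ln p)"
    by (intro sum_mono)
  also have "\<dots> = ln p" by (simp add: sum sum_distrib_right[symmetric])
  finally show ?thesis by (simp add: eq)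
qed

text \<open>Loops of equal length at a common vertex can be concatenated freely. Choosing them
  independently and uniformly, with a uniform phase for the origin, gives an invariant measure.\<close>

locale concatenated_loops =
  fixes G :: "'a pair_pre_digraph" and L :: "'a list set" and n :: nat and c :: 'a
  assumes wf: "pair_wf_digraph G"
    and n: "n > 0"
    and fin: "finite L" and ne: "L \<noteq> {}"
    and len: "\<And>w. w \<in> L \<Longrightarrow> length w = n"
    and start: "\<And>w. w \<in> L \<Longrightarrow> w ! 0 = c"
    and arc: "\<And>w i. w \<in> L \<Longrightarrow> Suc i < n \<Longrightarrow> (w ! i, w ! Suc i) \<in> parcs G"
    and arc_end: "\<And>w. w \<in> L \<Longrightarrow> (w ! (n - 1), c) \<in> parcs G"
begin

definition loop_choice :: "(int \<Rightarrow> 'a list) measure" where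
  "loop_choice = (\<Pi>\<^sub>M _\<in>UNIV. uniform_count_measure L)"

text \<open>The phase \<open>fst p\<close> is the offset of time 0 within loop number 0. Since
  \<open>div\<close> rounds down, the formula is right for negative times too.\<close>

definition concat_point :: "nat \<times> (int \<Rightarrow> 'a list) \<Rightarrow> int \<Rightarrow> 'a" where
  "concat_point p t = snd p ((t + int (fst p)) div int n) ! nat ((t + int (fst p)) mod int n)"

definition phase :: "nat measure" where
  "phase = uniform_count_measure {..<n}"

definition loop_measure :: "(int \<Rightarrow> 'a) measure" where
  "loop_measure = distr (phase \<Otimes>\<^sub>M loop_choice) (markov_space G) concat_point"

sublocale product_prob_space "\<lambda>_ :: int. uniform_count_measure L" UNIV
  by (rule product_prob_spaceI, rule prob_space_uniform_count_measure[OF fin ne])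

sublocale B: prob_space loop_choice
  unfolding loop_choice_def by unfold_locales

lemma space_loop_choice: "space loop_choice = {\<omega>. \<forall>j. \<omega> j \<in> L}"
  by (auto simp: loop_choice_def space_PiM space_uniform_count_measure PiE_def)

lemma space_phase: "space phase = {..<n}"
  by (simp add: phase_def space_uniform_count_measure)

lemma concat_point_arc:
  assumes "\<omega> \<in> space loop_choice"
  shows "(concat_point (i, \<omega>) t, concat_point (i, \<omega>) (t + 1)) \<in> parcs G"
proof -
  define s where "s = t + int i"
  define q where "q = s div int n"
  define r where "r = nat (s mod int n)"
  have r: "int r = s mod int n" "r < n" using n by (auto simp: r_def nat_less_iff)
  have s: "s = q * int n + int r" by (simp add: q_def r)
  have L: "\<omega> j \<in> L" for j using assms by (simp add: space_loop_choice)
  have x: "concat_point (i, \<omega>) t = \<omega> q ! r" by (simp add: concat_point_def q_def r_def s_def)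
  have eq: "t + 1 + int i = s + 1" by (simp add: s_def)
  show ?thesis
  proof (cases "Suc r < n")
    case True
    have "(s + 1) div int n = q" "(s + 1) mod int n = int (Suc r)"
      using True n unfolding s by (auto simp: add.assoc div_mult_self3 mod_pos_pos_trivial div_pos_pos_trivial)
    then have "concat_point (i, \<omega>) (t + 1) = \<omega> q ! Suc r"
      unfolding concat_point_def by (simp add: eq del: of_nat_Suc)
    then show ?thesis using arc[OF L True] x by simp
  next
    case False
    then have rn: "int r + 1 = int n" "r = n - 1" using r by auto
    then have "s + 1 = (q + 1) * int n" unfolding s by (simp add: algebra_simps)
    then have "concat_point (i, \<omega>) (t + 1) = \<omega> (q + 1) ! 0"
      using n by (simp add: concat_point_def eq)
    then show ?thesis using arc_end[OF L] start[OF L] x rn by simp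
  qed
qed

lemma concat_point_markov:
  assumes "\<omega> \<in> space loop_choice"
  shows "concat_point (i, \<omega>) \<in> markov_shift G"
proof -
  interpret pair_wf_digraph G by (rule wf)
  show ?thesis
    using concat_point_arc[OF assms, of i] in_arcsD1 by (auto simp: markov_shift_def)
qed

lemma space_markov: "space (markov_space G) = markov_shift G"
  by (auto simp: markov_space_def space_restrict_space space_PiM markov_shift_def)

lemma sets_phase: "sets phase = sets (count_space {..<n})"
  by (simp add: phase_def sets_uniform_count_measure_count_space)

lemma measurable_concat_point_phase: "(\<lambda>\<omega>. concat_point (i, \<omega>)) \<in> loop_choice \<rightarrow>\<^sub>M markov_space G"
  unfolding markov_space_def
proof (rule measurable_restrict_space2)
  show "(\<lambda>\<omega>. concat_point (i, \<omega>)) \<in> space loop_choice \<rightarrow> markov_shift G"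
    using concat_point_markov by auto
  show "(\<lambda>\<omega>. concat_point (i, \<omega>)) \<in> loop_choice \<rightarrow>\<^sub>M Pi\<^sub>M UNIV (\<lambda>_. count_space (pverts G))"
  proof (rule measurable_PiM_single'[where f = "\<lambda>t \<omega>. concat_point (i, \<omega>) t"])
    show "(\<lambda>\<omega> t. concat_point (i, \<omega>) t) \<in> space loop_choice \<rightarrow> (\<Pi>\<^sub>E t\<in>UNIV. space (count_space (pverts G)))"
      using concat_point_markov[of _ i] by (auto simp: markov_shift_def)
    fix t
    define q where "q = (t + int i) div int n"
    define r where "r = nat ((t + int i) mod int n)"
    have "(\<lambda>\<omega>. \<omega> q) \<in> loop_choice \<rightarrow>\<^sub>M uniform_count_measure L"
      unfolding loop_choice_def by (rule measurable_component_singleton) simp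
    then have "(\<lambda>\<omega>. \<omega> q ! r) \<in> loop_choice \<rightarrow>\<^sub>M count_space UNIV"
      by (rule measurable_compose)
        (auto simp: measurable_def sets_uniform_count_measure space_uniform_count_measure)
    then have m: "(\<lambda>\<omega>. concat_point (i, \<omega>) t) \<in> loop_choice \<rightarrow>\<^sub>M count_space UNIV"
      by (simp add: concat_point_def q_def r_def)
    have V: "concat_point (i, \<omega>) t \<in> pverts G" if "\<omega> \<in> space loop_choice" for \<omega>
      using concat_point_markov[OF that, of i] by (auto simp: markov_shift_def)
    show "(\<lambda>\<omega>. concat_point (i, \<omega>) t) \<in> loop_choice \<rightarrow>\<^sub>M count_space (pverts G)"
      using V by (intro measurableI) (auto intro: measurable_sets[OF m])
  qed
qed

lemma measurable_concat_point [measurable]: "concat_point \<in> phase \<Otimes>\<^sub>M loop_choice \<rightarrow>\<^sub>M markov_space G"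
proof -
  have "concat_point \<in> count_space {..<n} \<Otimes>\<^sub>M loop_choice \<rightarrow>\<^sub>M markov_space G"
    by (rule measurable_pair_measure_countable1) (auto intro: measurable_concat_point_phase)
  also have "(count_space {..<n} \<Otimes>\<^sub>M loop_choice \<rightarrow>\<^sub>M markov_space G) = (phase \<Otimes>\<^sub>M loop_choice \<rightarrow>\<^sub>M markov_space G)"
    by (intro measurable_cong_sets sets_pair_measure_cong) (auto simp: sets_phase)
  finally show ?thesis .
qed

lemma sets_loop_measure [measurable_cong]: "sets loop_measure = sets (markov_space G)"
  by (simp add: loop_measure_def)

lemma space_loop_measure: "space loop_measure = markov_shift G"
  by (simp add: loop_measure_def space_markov)

lemma emeasure_loop_measure:
  assumes A: "A \<in> sets (markov_space G)"
  shows "emeasure loop_measure A =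
    (\<Sum>i<n. ennreal (1 / real n) * emeasure loop_choice {\<omega> \<in> space loop_choice. concat_point (i, \<omega>) \<in> A})"
proof -
  have X: "concat_point -` A \<inter> space (phase \<Otimes>\<^sub>M loop_choice) \<in> sets (phase \<Otimes>\<^sub>M loop_choice)"
    using A by measurable
  have "emeasure loop_measure A = emeasure (phase \<Otimes>\<^sub>M loop_choice) (concat_point -` A \<inter> space (phase \<Otimes>\<^sub>M loop_choice))"
    unfolding loop_measure_def using A by (intro emeasure_distr) auto
  also have "\<dots> = (\<integral>\<^sup>+i. emeasure loop_choice (Pair i -` (concat_point -` A \<inter> space (phase \<Otimes>\<^sub>M loop_choice))) \<partial>phase)"
    by (rule B.emeasure_pair_measure_alt[OF X])
  also have "\<dots> = (\<Sum>i<n. ennreal (1 / real n) *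
      emeasure loop_choice (Pair i -` (concat_point -` A \<inter> space (phase \<Otimes>\<^sub>M loop_choice))))"
    unfolding phase_def[THEN arg_cong, of "\<lambda>M. integral\<^sup>N M _"] uniform_count_measure_def
    by (subst nn_integral_point_measure_finite) auto
  also have "\<dots> = (\<Sum>i<n. ennreal (1 / real n) * emeasure loop_choice {\<omega> \<in> space loop_choice. concat_point (i, \<omega>) \<in> A})"
  proof (intro sum.cong refl arg_cong2[where f = "(*)"] arg_cong[where f = "emeasure loop_choice"])
    fix i assume "i \<in> {..<n}"
    then show "Pair i -` (concat_point -` A \<inter> space (phase \<Otimes>\<^sub>M loop_choice)) = {\<omega> \<in> space loop_choice. concat_point (i, \<omega>) \<in> A}"
      by (auto simp: space_pair_measure space_phase)
  qed
  finally show ?thesis .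
qed

sublocale LM: prob_space loop_measure
proof -
  interpret phase: prob_space phase
    unfolding phase_def using n by (intro prob_space_uniform_count_measure) auto
  have "prob_space (phase \<Otimes>\<^sub>M loop_choice)"
    by (intro prob_space_pair phase.prob_space_axioms B.prob_space_axioms)
  then show "prob_space loop_measure"
    unfolding loop_measure_def by (rule prob_space.prob_space_distr) measurable
qed

lemma measurable_left_shift: "left_shift \<in> markov_space G \<rightarrow>\<^sub>M markov_space G"
  unfolding markov_space_def
proof (rule measurable_restrict_space2)
  show "left_shift \<in> space (restrict_space (Pi\<^sub>M UNIV (\<lambda>_. count_space (pverts G))) (markov_shift G))
      \<rightarrow> markov_shift G"
  proof
    fix x assume "x \<in> space (restrict_space (Pi\<^sub>M UNIV (\<lambda>_. count_space (pverts G))) (markov_shift G))"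
    then have x: "x t \<in> pverts G \<and> (x t, x (t + 1)) \<in> parcs G" for t
      by (simp add: space_restrict_space markov_shift_def)
    show "left_shift x \<in> markov_shift G"
      unfolding markov_shift_def left_shift_def using x by blast
  qed
  show "left_shift \<in> restrict_space (Pi\<^sub>M UNIV (\<lambda>_. count_space (pverts G))) (markov_shift G)
      \<rightarrow>\<^sub>M Pi\<^sub>M UNIV (\<lambda>_. count_space (pverts G))"
    unfolding left_shift_def
  proof (intro measurable_restrict_space1 measurable_PiM_single')
    show "(\<lambda>x t. x (t + 1)) \<in> space (Pi\<^sub>M UNIV (\<lambda>_. count_space (pverts G))) \<rightarrow>
        (\<Pi>\<^sub>E t\<in>(UNIV :: int set). space (count_space (pverts G)))"
      by (auto simp: space_PiM)
  qed (rule measurable_component_singleton, simp)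
qed

text \<open>Independent identically distributed coordinates may be renumbered.\<close>

lemma loop_choice_shift:
  assumes "A \<in> sets loop_choice"
  shows "emeasure loop_choice {\<omega> \<in> space loop_choice. (\<lambda>j. \<omega> (j + 1)) \<in> A} = emeasure loop_choice A"
proof -
  have "distr loop_choice loop_choice (\<lambda>\<omega> j. \<omega> (j + 1)) = loop_choice"
    using distr_PiM_reindex[of UNIV "\<lambda>_. uniform_count_measure L" "\<lambda>j :: int. j + 1" UNIV]
    by (simp add: loop_choice_def prob_space_uniform_count_measure[OF fin ne] restrict_def)
  moreover have "(\<lambda>\<omega> j. \<omega> (j + 1)) \<in> loop_choice \<rightarrow>\<^sub>M loop_choice"
    unfolding loop_choice_def
    by (intro measurable_PiM_single' measurable_component_singleton)
      (auto simp: space_PiM PiE_def)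
  ultimately have "emeasure loop_choice A = emeasure loop_choice ((\<lambda>\<omega> j. \<omega> (j + 1)) -` A \<inter> space loop_choice)"
    using assms by (metis emeasure_distr)
  then show ?thesis by (simp add: vimage_def Int_def conj_commute)
qed

text \<open>Shifting raises the phase by 1. Phase n is phase 0 with the loops renumbered by 1, which
  leaves their distribution unchanged; so the uniform average over the n phases is only permuted
  cyclically.\<close>

lemma loop_measure_invariant: "loop_measure \<in> invariant_measures G"
proof -
  have meas: "left_shift \<in> loop_measure \<rightarrow>\<^sub>M loop_measure"
    using measurable_left_shift measurable_cong_sets[OF sets_loop_measure sets_loop_measure] by simp
  have "distr loop_measure loop_measure left_shift = loop_measure"
  proof (rule measure_eqI)
    fix A assume "A \<in> sets (distr loop_measure loop_measure left_shift)"
    then have A: "A \<in> sets loop_measure" "A \<in> sets (markov_space G)" by (auto simp: sets_loop_measure)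
    define \<nu> where "\<nu> i = emeasure loop_choice {\<omega> \<in> space loop_choice. concat_point (i, \<omega>) \<in> A}" for i
    let ?A = "left_shift -` A \<inter> space loop_measure"
    have sA: "?A \<in> sets (markov_space G)"
      using measurable_sets[OF meas A(1)] by (simp add: sets_loop_measure)
    have "{\<omega> \<in> space loop_choice. concat_point (i, \<omega>) \<in> ?A} = {\<omega> \<in> space loop_choice. concat_point (Suc i, \<omega>) \<in> A}" for i
    proof -
      have "left_shift (concat_point (i, \<omega>)) = concat_point (Suc i, \<omega>)" for \<omega>
        by (simp add: left_shift_def concat_point_def fun_eq_iff add_ac)
      then show ?thesis using concat_point_markov by (auto simp: space_loop_measure)
    qed
    then have "emeasure loop_measure ?A = (\<Sum>i<n. ennreal (1 / real n) * \<nu> (Suc i))"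
      by (simp add: emeasure_loop_measure[OF sA] \<nu>_def)
    also have "\<dots> = (\<Sum>i<n. ennreal (1 / real n) * \<nu> i)"
    proof -
      have "\<nu> n = \<nu> 0"
      proof -
        have mem: "{\<omega> \<in> space loop_choice. concat_point (0, \<omega>) \<in> A} \<in> sets loop_choice"
          using measurable_sets[OF measurable_concat_point_phase A(2), of 0]
          by (simp add: vimage_def Int_def conj_commute)
        have "concat_point (n, \<omega>) = concat_point (0, \<lambda>j. \<omega> (j + 1))" for \<omega>
          using n by (simp add: concat_point_def fun_eq_iff)
        then have "{\<omega> \<in> space loop_choice. concat_point (n, \<omega>) \<in> A} =
            {\<omega> \<in> space loop_choice. (\<lambda>j. \<omega> (j + 1)) \<in> {\<omega> \<in> space loop_choice. concat_point (0, \<omega>) \<in> A}}"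
          by (auto simp: space_loop_choice)
        then show ?thesis
          unfolding \<nu>_def by (simp only: loop_choice_shift[OF mem])
      qed
      moreover obtain m where m: "n = Suc m" using n by (cases n) auto
      moreover define g where "g i = ennreal (1 / real n) * \<nu> i" for i
      ultimately have "g (Suc m) = g 0" by simp
      then have "(\<Sum>i<Suc m. g (Suc i)) = (\<Sum>i<Suc m. g i)"
        by (simp only: sum.lessThan_Suc[of "\<lambda>i. g (Suc i)"] sum.lessThan_Suc_shift[of g]) (simp add: add.commute)
      then show ?thesis by (simp only: g_def m)
    qed
    also have "\<dots> = emeasure loop_measure A"
      by (simp add: emeasure_loop_measure[OF A(2)] \<nu>_def)
    finally show "emeasure (distr loop_measure loop_measure left_shift) A = emeasure loop_measure A"
      by (subst emeasure_distr[OF meas A(1)])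
  qed simp
  then show ?thesis
    using LM.prob_space_axioms meas sets_loop_measure by (simp add: invariant_measures_def)
qed

text \<open>At phase i the coordinate at time 0 is letter i of loop number 0, so only phases in
  \<open>I\<close> contribute, each with weight at most 1/n.\<close>

lemma measure_loop_measure_le:
  assumes I: "\<And>w i. w \<in> L \<Longrightarrow> i < n \<Longrightarrow> w ! i \<in> F \<Longrightarrow> i \<in> I" and fI: "finite I"
  shows "measure loop_measure {x \<in> markov_shift G. x 0 \<in> F} \<le> real (card I) / real n"
proof (cases "{x \<in> markov_shift G. x 0 \<in> F} \<in> sets loop_measure")
  case True
  let ?A = "{x \<in> markov_shift G. x 0 \<in> F}"
  have "emeasure loop_measure ?A =
      (\<Sum>i<n. ennreal (1 / real n) * emeasure loop_choice {\<omega> \<in> space loop_choice. concat_point (i, \<omega>) \<in> ?A})"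
    using True by (intro emeasure_loop_measure) (simp add: sets_loop_measure)
  also have "\<dots> \<le> (\<Sum>i<n. ennreal (if i \<in> I then 1 / real n else 0))"
  proof (rule sum_mono)
    fix i assume "i \<in> {..<n}"
    then have "concat_point (i, \<omega>) 0 \<notin> F" if "i \<notin> I" "\<omega> \<in> space loop_choice" for \<omega>
      using that I[of "\<omega> 0" i] n by (auto simp: concat_point_def space_loop_choice)
    then have empty: "{\<omega> \<in> space loop_choice. concat_point (i, \<omega>) \<in> ?A} = {}" if "i \<notin> I"
      using that by auto
    show "ennreal (1 / real n) * emeasure loop_choice {\<omega> \<in> space loop_choice. concat_point (i, \<omega>) \<in> ?A} \<le>
        ennreal (if i \<in> I then 1 / real n else 0)"
    proof (cases "i \<in> I")
      case True
      then show ?thesis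
        using mult_left_mono[OF B.emeasure_le_1, of "ennreal (1 / real n)"] by simp
    next
      case False
      then show ?thesis unfolding empty[OF False] by simp
    qed
  qed
  also have "\<dots> = ennreal (\<Sum>i<n. (if i \<in> I then 1 / real n else 0))"
    by (rule sum_ennreal) auto
  also have "\<dots> \<le> ennreal (real (card I) / real n)"
  proof (rule ennreal_leI)
    have "(\<Sum>i<n. (if i \<in> I then 1 / real n else 0)) = real (card ({..<n} \<inter> I)) / real n"
      by (simp add: sum.If_cases)
    also have "\<dots> \<le> real (card I) / real n"
      using fI by (intro divide_right_mono) (auto intro: card_mono)
    finally show "(\<Sum>i<n. (if i \<in> I then 1 / real n else 0)) \<le> real (card I) / real n" .
  qed
  finally show ?thesis
    by (simp add: LM.emeasure_eq_measure)
\<comment> \<open>A set outside the sigma-algebra has \<open>measure\<close> 0 by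
  convention.\<close>
qed (simp add: measure_notin_sets)

text \<open>The partition reads off the vertex at time 0. Whatever the phase, a window of length n(q
  + 1) contains q complete loops, and its itinerary determines them. These are independent and
  uniform, so no atom has more than \<open>(1 / card L) ^ q\<close> of the mass; letting q grow
  gives the claimed rate.\<close>

lemma ks_entropy_loop_measure:
  "ks_entropy loop_measure left_shift \<ge> ereal (ln (real (card L)) / real n)"
proof -
  define V where "V = \<Union> (set ` L)"
  have "finite V" using fin by (simp add: V_def)
  then obtain g :: "'a \<Rightarrow> nat" where g: "inj_on g V"
    using finite_imp_inj_to_nat_seg by blast
  \<comment> \<open>The value 0 may collide with the code of a vertex in \<open>V\<close>; this is
    harmless, since injectivity is only used on the letters of loops. The finite range makes the
    partition finite.\<close>
  define f where "f v = (if v \<in> V then g v else 0)" for v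
  define \<xi> where "\<xi> x = f (x 0)" for x :: "int \<Rightarrow> 'a"
  have fV: "inj_on f V" using g by (simp add: inj_on_def f_def)
  have finf: "finite (range f)"
    by (rule finite_subset[of _ "insert 0 (g ` V)"]) (auto simp: f_def \<open>finite V\<close>)
  have cyl: "{x \<in> space loop_measure. x t \<in> S} \<in> sets loop_measure" for t S
  proof -
    have "(\<lambda>x. x t) \<in> markov_space G \<rightarrow>\<^sub>M count_space (pverts G)"
      unfolding markov_space_def by (intro measurable_restrict_space1 measurable_component_singleton) simp
    from measurable_sets[OF this, of "S \<inter> pverts G"]
    have "(\<lambda>x. x t) -` (S \<inter> pverts G) \<inter> space (markov_space G) \<in> sets (markov_space G)" by simp
    also have "(\<lambda>x. x t) -` (S \<inter> pverts G) \<inter> space (markov_space G) = {x \<in> space loop_measure. x t \<in> S}"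
      by (auto simp: space_markov space_loop_measure markov_shift_def)
    finally show ?thesis by (simp add: sets_loop_measure)
  qed
  have itin: "itinerary left_shift \<xi> m x = map (\<lambda>k. f (x (int k))) [0..<m]" for m x
    by (simp add: itinerary_def left_shift_funpow \<xi>_def)
  have simple: "simple_function loop_measure (itinerary left_shift \<xi> m)" for m
    unfolding simple_function_def
  proof safe
    have "itinerary left_shift \<xi> m ` space loop_measure \<subseteq> {xs. set xs \<subseteq> range f \<and> length xs = m}"
      by (auto simp: itin)
    then show "finite (itinerary left_shift \<xi> m ` space loop_measure)"
      using finite_lists_length_eq[OF finf] by (rule finite_subset)
    fix x
    \<comment> \<open>The outer \<open>space loop_measure\<close> covers m = 0, where the
      intersection over the empty index set is \<open>UNIV\<close>.\<close>
    have "itinerary left_shift \<xi> m -` {itinerary left_shift \<xi> m x} \<inter> space loop_measure =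
        space loop_measure \<inter> (\<Inter>k<m. {y \<in> space loop_measure. y (int k) \<in> f -` {f (x (int k))}})"
      by (auto simp: itin)
    also have "\<dots> \<in> sets loop_measure"
      using cyl[of "int _" "f -` {f (x (int _))}"]
      by (cases "m = 0") (auto intro!: sets.Int sets.finite_INT simp: vimage_def)
    finally show "itinerary left_shift \<xi> m -` {itinerary left_shift \<xi> m x} \<inter> space loop_measure
        \<in> sets loop_measure" .
  qed
  have simple1: "simple_function loop_measure \<xi>"
    unfolding simple_function_def
  proof safe
    show "finite (\<xi> ` space loop_measure)"
      by (rule finite_subset[OF _ finf]) (auto simp: \<xi>_def)
    fix x
    have "\<xi> -` {\<xi> x} \<inter> space loop_measure = {y \<in> space loop_measure. y 0 \<in> f -` {\<xi> x}}"
      by (auto simp: \<xi>_def)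
    then show "\<xi> -` {\<xi> x} \<inter> space loop_measure \<in> sets loop_measure"
      using cyl[of 0 "f -` {\<xi> x}"] by simp
  qed
  define N where "N = card L"
  have N: "N > 0" using fin ne by (simp add: N_def card_gt_0_iff)
  have bound: "real q * ln (real N) \<le> partition_entropy loop_measure (itinerary left_shift \<xi> (n * (q + 1)))" for q
  proof -
    define m where "m = n * (q + 1)"
    have prob: "LM.prob (itinerary left_shift \<xi> m -` {s} \<inter> space loop_measure) \<le> (1 / real N) ^ q" for s
    proof -
      let ?A = "itinerary left_shift \<xi> m -` {s} \<inter> space loop_measure"
      have A: "?A \<in> sets loop_measure"
        using simple_functionD(2)[OF simple] .
      have le: "emeasure loop_choice {\<omega> \<in> space loop_choice. concat_point (i, \<omega>) \<in> ?A} \<le> ennreal ((1 / real N) ^ q)"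
        if i: "i < n" for i
      proof -
        \<comment> \<open>The loops that can stand at number j if the itinerary is \<open>s\<close>:
          at phase i, letter r of loop j is read at time jn + r - i. For j = 1, ..., q and i, r < n
          this time lies within the window; loop 0 may be cut off by the origin and is
          dropped.\<close>
        define X where "X j = {w \<in> L. \<forall>r<n. f (w ! r) = s ! nat (j * int n + int r - int i)}" for j
        have card: "card (X j) \<le> 1" for j
        proof -
          have "w = w'" if "w \<in> X j" "w' \<in> X j" for w w'
          proof (rule nth_equalityI)
            show "length w = length w'" using that len by (auto simp: X_def)
            fix r assume r: "r < length w"
            then have "r < n" using that len by (auto simp: X_def)
            then have "f (w ! r) = f (w' ! r)" using that by (auto simp: X_def)
            moreover have "w ! r \<in> V" "w' ! r \<in> V"
              using that \<open>r < n\<close> len by (auto simp: V_def X_def intro!: bexI nth_mem)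
            ultimately show "w ! r = w' ! r" using fV by (auto dest: inj_onD)
          qed
          then show ?thesis by (auto simp: card_le_Suc0_iff_eq[OF finite_subset[OF _ fin]] X_def)
        qed
        have "{\<omega> \<in> space loop_choice. concat_point (i, \<omega>) \<in> ?A} \<subseteq> {\<omega> \<in> space loop_choice. \<forall>j\<in>{1..int q}. \<omega> j \<in> X j}"
        proof safe
          fix \<omega> j assume \<omega>: "\<omega> \<in> space loop_choice" and j: "j \<in> {1..int q}"
            and s: "s = itinerary left_shift \<xi> m (concat_point (i, \<omega>))"
          have "f (\<omega> j ! r) = s ! nat (j * int n + int r - int i)" if r: "r < n" for r
          proof -
            define k where "k = nat (j * int n + int r - int i)"
            have jn: "1 * int n \<le> j * int n" "j * int n \<le> int q * int n"
              using j mult_right_mono[of 1 j "int n"] mult_right_mono[of j "int q" "int n"] by auto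
            have m: "int m = int q * int n + int n" by (simp add: m_def algebra_simps)
            have k: "int k = j * int n + int r - int i"
              unfolding k_def using jn i r by (intro nat_0_le) linarith
            have "int k < int m"
              unfolding k m using jn i r by linarith
            then have "s ! k = f (concat_point (i, \<omega>) (int k))" by (simp add: s itin)
            also have "concat_point (i, \<omega>) (int k) = \<omega> j ! r"
              using r n by (simp add: concat_point_def k div_mult_self3 div_pos_pos_trivial mod_pos_pos_trivial)
            finally show ?thesis by (simp add: k_def)
          qed
          then show "\<omega> j \<in> X j" using \<omega> by (auto simp: X_def space_loop_choice)
        qed
        moreover have "{\<omega> \<in> space loop_choice. \<forall>j\<in>{1..int q}. \<omega> j \<in> X j} \<in> sets loop_choice"
          unfolding loop_choice_def
          by (intro sets.sets_Collect_finite_All sets_Collect_single')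
            (auto simp: sets_uniform_count_measure space_uniform_count_measure X_def)
        ultimately have "emeasure loop_choice {\<omega> \<in> space loop_choice. concat_point (i, \<omega>) \<in> ?A} \<le>
            emeasure loop_choice {\<omega> \<in> space loop_choice. \<forall>j\<in>{1..int q}. \<omega> j \<in> X j}"
          by (rule emeasure_mono)
        also have "\<dots> = (\<Prod>j\<in>{1..int q}. emeasure (uniform_count_measure L) (X j))"
          unfolding loop_choice_def
          by (rule emeasure_PiM_Collect[where J = "{1..int q}" and X = X])
            (auto simp: sets_uniform_count_measure X_def)
        also have "\<dots> = (\<Prod>j\<in>{1..int q}. ennreal (real (card (X j)) / real N))"
          unfolding N_def
          by (intro prod.cong refl emeasure_uniform_count_measure[OF fin]) (auto simp: X_def)
        also have "\<dots> = ennreal (\<Prod>j\<in>{1..int q}. real (card (X j)) / real N)"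
          by (rule prod_ennreal) auto
        also have "\<dots> \<le> ennreal ((1 / real N) ^ q)"
        proof (rule ennreal_leI)
          have "(\<Prod>j\<in>{1..int q}. real (card (X j)) / real N) \<le> (\<Prod>j\<in>{1..int q}. 1 / real N)"
            using card by (intro prod_mono) (auto intro: divide_right_mono)
          then show "(\<Prod>j\<in>{1..int q}. real (card (X j)) / real N) \<le> (1 / real N) ^ q" by simp
        qed
        finally show ?thesis .
      qed
      have "emeasure loop_measure ?A =
          (\<Sum>i<n. ennreal (1 / real n) * emeasure loop_choice {\<omega> \<in> space loop_choice. concat_point (i, \<omega>) \<in> ?A})"
        using A by (intro emeasure_loop_measure) (simp add: sets_loop_measure)
      also have "\<dots> \<le> (\<Sum>i<n. ennreal (1 / real n) * ennreal ((1 / real N) ^ q))"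
        by (intro sum_mono mult_left_mono le) auto
      also have "\<dots> = (\<Sum>i<n. ennreal (1 / real n * (1 / real N) ^ q))"
        by (intro sum.cong refl ennreal_mult[symmetric]) auto
      also have "\<dots> = ennreal (\<Sum>i<n. 1 / real n * (1 / real N) ^ q)"
        by (rule sum_ennreal) auto
      also have "(\<Sum>i<n. 1 / real n * (1 / real N) ^ q) = (1 / real N) ^ q"
        using n by simp
      finally show ?thesis
        by (simp add: LM.emeasure_eq_measure ennreal_le_iff)
    qed
    have "- ln ((1 / real N) ^ q) \<le> partition_entropy loop_measure (itinerary left_shift \<xi> m)"
      using N by (intro LM.partition_entropy_ge[OF simple _ prob]) auto
    moreover have "- ln ((1 / real N) ^ q) = real q * ln (real N)"
      using N by (simp add: ln_realpow ln_div)
    ultimately show ?thesis by (simp add: m_def)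
  qed
  let ?H = "\<lambda>m. ereal (partition_entropy loop_measure (itinerary left_shift \<xi> m) / real m)"
  \<comment> \<open>A lower bound along the multiples of n suffices, since \<open>ks_entropy\<close>
    takes an upper limit.\<close>
  let ?r = "\<lambda>q. n * (q + 1)"
  have "(\<lambda>q. real q / real (q + 1) * (ln (real N) / real n)) \<longlonglongrightarrow> 1 * (ln (real N) / real n)"
    by (intro tendsto_mult tendsto_const) real_asymp
  then have lim: "(\<lambda>q. ereal (real q / real (q + 1) * (ln (real N) / real n))) \<longlonglongrightarrow>
      ereal (ln (real N) / real n)"
    by simp
  have "ereal (ln (real N) / real n) = limsup (\<lambda>q. ereal (real q / real (q + 1) * (ln (real N) / real n)))"
    using lim_imp_Limsup[OF _ lim] by simp
  also have "\<dots> \<le> limsup (?H \<circ> ?r)"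
  proof (intro Limsup_mono always_eventually allI)
    fix q
    have "real q / real (q + 1) * (ln (real N) / real n) = real q * ln (real N) / real (?r q)"
      unfolding of_nat_mult by simp
    also have "\<dots> \<le> partition_entropy loop_measure (itinerary left_shift \<xi> (?r q)) / real (?r q)"
      by (intro divide_right_mono bound) auto
    finally show "ereal (real q / real (q + 1) * (ln (real N) / real n)) \<le> (?H \<circ> ?r) q"
      by simp
  qed
  also have "\<dots> \<le> limsup ?H"
    by (rule limsup_subseq_mono) (use n in \<open>auto simp: strict_mono_def\<close>)
  also have "\<dots> \<le> ks_entropy loop_measure left_shift"
    unfolding ks_entropy_def using simple1 by (intro SUP_upper) auto
  finally show ?thesis by (simp add: N_def)
qed

end

section \<open>Analytic continuation\<close>

text \<open>The identity theorem applied to the difference, which on a connected open set either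
  vanishes or is non-zero off a sparse set. Equality is stated on punctured neighbourhoods because a
  meromorphic function has arbitrary values at isolated points.\<close>

lemma meromorphic_eq_continuation:
  assumes "f meromorphic_on A" "g meromorphic_on A" "open A" "Topological_Spaces.connected A"
    and "a \<in> A" "eventually (\<lambda>z. f z = g z) (at a)" "b \<in> A"
  shows "eventually (\<lambda>z. f z = g z) (at b)"
proof -
  have "(\<lambda>z. f z - g z) meromorphic_on A"
    by (intro meromorphic_intros assms)
  then consider "eventually (\<lambda>z. f z - g z = 0) (cosparse A)" | "eventually (\<lambda>z. f z - g z \<noteq> 0) (cosparse A)"
    using meromorphic_imp_constant_or_avoid assms(3,4) by blast
  then show ?thesis
  proof cases
    case 1
    then show ?thesis using assms(3,7) by (simp add: eventually_cosparse_open_eq)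
  next
    case 2
    then have "eventually (\<lambda>z. f z \<noteq> g z) (at a)"
      using assms(3,5) by (simp add: eventually_cosparse_open_eq)
    with assms(6) have "eventually (\<lambda>z. False) (at a)"
      by eventually_elim auto
    then show ?thesis by simp
  qed
qed

text \<open>Only the germ of \<open>f\<close> at 0 matters: \<open>f\<close> will be built from
  \<open>eval_fps\<close>, which carries no information outside the disc of convergence.\<close>

definition germ_extends :: "ereal \<Rightarrow> (complex \<Rightarrow> complex) \<Rightarrow> bool" where
  "germ_extends R f \<longleftrightarrow> (\<exists>g. g meromorphic_on eball 0 R \<and> eventually (\<lambda>z. g z = f z) (at 0))"

lemma germ_extends_cong:
  assumes "germ_extends R f" "eventually (\<lambda>z. f z = f' z) (at 0)"
  shows "germ_extends R f'"
proof -
  obtain g where "g meromorphic_on eball 0 R" "eventually (\<lambda>z. g z = f z) (at 0)"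
    using assms(1) by (auto simp: germ_extends_def)
  moreover from this(2) assms(2) have "eventually (\<lambda>z. g z = f' z) (at 0)"
    by eventually_elim simp
  ultimately show ?thesis by (auto simp: germ_extends_def)
qed

lemma germ_extends_binop:
  assumes "germ_extends R f" "germ_extends R g"
    and "\<And>f' g'. f' meromorphic_on eball 0 R \<Longrightarrow> g' meromorphic_on eball 0 R \<Longrightarrow>
      (\<lambda>z. h (f' z) (g' z)) meromorphic_on eball 0 R"
  shows "germ_extends R (\<lambda>z. h (f z) (g z))"
proof -
  obtain f' g' where f': "f' meromorphic_on eball 0 R" "eventually (\<lambda>z. f' z = f z) (at 0)"
    and g': "g' meromorphic_on eball 0 R" "eventually (\<lambda>z. g' z = g z) (at 0)"
    using assms(1,2) by (auto simp: germ_extends_def)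
  have "eventually (\<lambda>z. h (f' z) (g' z) = h (f z) (g z)) (at 0)"
    using f'(2) g'(2) by eventually_elim simp
  then show ?thesis
    using assms(3)[OF f'(1) g'(1)] by (auto simp: germ_extends_def)
qed

lemmas germ_extends_add = germ_extends_binop[where h = "(+)", OF _ _ meromorphic_on_add]
  and germ_extends_diff = germ_extends_binop[where h = "(-)", OF _ _ meromorphic_on_diff]
  and germ_extends_mult = germ_extends_binop[where h = "(*)", OF _ _ meromorphic_on_mult]
  and germ_extends_divide = germ_extends_binop[where h = "(/)", OF _ _ meromorphic_on_divide]

lemma germ_extends_meromorphic: "f meromorphic_on eball 0 R \<Longrightarrow> germ_extends R f"
  by (auto simp: germ_extends_def)

text \<open>Continuations to different discs agree up to isolated points by the identity theorem,
  and pointwise after \<open>remove_sings\<close>. They can therefore be glued by using at each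
  point any disc that contains it.\<close>

lemma germ_extends_exhaustion:
  assumes "\<And>r. 0 < r \<Longrightarrow> ereal r < R \<Longrightarrow> germ_extends (ereal r) f"
  shows "germ_extends R f"
proof (cases "R > 0")
  case False
  then have "eball 0 R = ({} :: complex set)"
    by (auto simp: eball_def not_less) (metis dual_order.strict_trans1 ereal_less_eq(5) norm_ge_zero not_le)
  then show ?thesis
    by (auto simp: germ_extends_def intro: exI[of _ f])
next
  case True
  have "\<exists>g. 0 < r \<longrightarrow> ereal r < R \<longrightarrow> g meromorphic_on ball 0 r \<and> eventually (\<lambda>z. g z = f z) (at 0)" for r
    using assms[of r] by (auto simp: germ_extends_def)
  then obtain g where g: "g r meromorphic_on ball 0 r" "eventually (\<lambda>z. g r z = f z) (at 0)"
    if "0 < r" "ereal r < R" for r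
    by metis
  have "\<exists>r. norm z < r \<and> ereal r < R" if "z \<in> eball 0 R" for z :: complex
    using that ereal_dense2[of "ereal (norm z)" R] by (auto simp: eball_def)
  then obtain \<rho> where \<rho>: "norm z < \<rho> z" "ereal (\<rho> z) < R" if "z \<in> eball 0 R" for z :: complex
    by metis
  define h where "h z = remove_sings (g (\<rho> z)) z" for z
  have h: "h z = remove_sings (g r) z" if r: "ereal r < R" and z: "norm z < r" for r z
  proof -
    have zR: "z \<in> eball 0 R" using r z by (simp add: eball_def less_trans[of "ereal (norm z)" "ereal r"])
    \<comment> \<open>The smaller disc lies in both domains and contains 0, where the germs agree,
      as well as \<open>z\<close>.\<close>
    define m where "m = min r (\<rho> z)"
    have m: "0 < m" "m \<le> r" "m \<le> \<rho> z" "norm z < m"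
      using \<rho>[OF zR] z by (auto simp: m_def intro: le_less_trans[OF norm_ge_zero])
    have "eventually (\<lambda>w. g (\<rho> z) w = g r w) (at z)"
    proof (rule meromorphic_eq_continuation)
      show "g (\<rho> z) meromorphic_on ball 0 m" "g r meromorphic_on ball 0 m"
        using g(1)[of "\<rho> z"] g(1)[of r] \<rho>[OF zR] r m
        by (auto intro: meromorphic_on_subset)
      have "eventually (\<lambda>w. g (\<rho> z) w = f w) (at 0)" "eventually (\<lambda>w. g r w = f w) (at 0)"
        using g(2)[of "\<rho> z"] g(2)[of r] \<rho>[OF zR] r m by auto
      then show "eventually (\<lambda>w. g (\<rho> z) w = g r w) (at 0)"
        by eventually_elim simp
    qed (use m in auto)
    then show ?thesis unfolding h_def by (rule remove_sings_cong) simp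
  qed
  have h_ev: "eventually (\<lambda>w. h w = remove_sings (g r) w) (at z)"
    if "ereal r < R" "norm z < r" for r z
    using eventually_at_in_open'[of "ball 0 r" z] that
    by (rule_tac eventually_mono[OF eventually_at_in_open'[of "ball 0 r" z]]) (auto intro!: h)
  have "h meromorphic_on eball 0 R"
  proof (subst meromorphic_on_meromorphic_at, rule ballI)
    fix z :: complex assume z: "z \<in> eball 0 R"
    have r: "0 < \<rho> z" using \<rho>[OF z] by (auto intro: le_less_trans[OF norm_ge_zero])
    have "remove_sings (g (\<rho> z)) meromorphic_on {z}"
      using g(1)[OF r \<rho>(2)[OF z]] \<rho>(1)[OF z]
      by (intro remove_sings_meromorphic) (auto intro: meromorphic_on_subset)
    then show "h meromorphic_on {z}"
      using h_ev[of "\<rho> z" z] \<rho>[OF z]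
      by (subst meromorphic_on_cong[of _ _ "remove_sings (g (\<rho> z))"]) auto
  qed
  moreover have "eventually (\<lambda>z. h z = f z) (at 0)"
  proof -
    obtain r where r: "0 < r" "ereal r < R"
      using ereal_dense2[OF True] by (auto simp: zero_ereal_def)
    have "isolated_singularity_at (g r) 0"
      using g(1)[OF r] r by (intro meromorphic_on_isolated_singularity) (auto intro: meromorphic_on_subset)
    then have "eventually (\<lambda>w. remove_sings (g r) w = g r w) (at 0)"
      by (rule eventually_remove_sings_eq_at)
    moreover have "eventually (\<lambda>w. h w = remove_sings (g r) w) (at 0)"
      using r by (intro h_ev) auto
    ultimately show ?thesis using g(2)[OF r] by eventually_elim simp
  qed
  ultimately show ?thesis by (auto simp: germ_extends_def)
qed

section \<open>Zeta functions as power series\<close>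

text \<open>The formal primitive of Q/X when Q has no constant term. At index 0 the division by zero
  yields the constant term 0.\<close>

definition log_fps :: "complex fps \<Rightarrow> complex fps" where
  "log_fps Q = Abs_fps (\<lambda>n. fps_nth Q n / of_nat n)"

lemma log_fps_add: "log_fps (P + Q) = log_fps P + log_fps Q"
  by (rule fps_ext) (simp add: log_fps_def add_divide_distrib)

lemma fps_deriv_log_fps:
  assumes "Q = fps_X * D"
  shows "fps_deriv (log_fps Q) = D"
  by (rule fps_ext) (simp add: log_fps_def assms del: of_nat_Suc)

lemma fps_conv_radius_log_fps: "fps_conv_radius Q \<le> fps_conv_radius (log_fps Q)"
  unfolding fps_conv_radius_def
proof (rule conv_radius_geI_ex')
  fix r :: real assume r: "0 < r" "ereal r < conv_radius (fps_nth Q)"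
  have "summable (\<lambda>n. norm (fps_nth Q n * of_real r ^ n))"
    using r by (intro abs_summable_in_conv_radius) auto
  then show "summable (\<lambda>n. fps_nth (log_fps Q) n * of_real r ^ n)"
  proof (rule summable_comparison_test[rotated], intro exI[of _ 0] allI impI)
    fix n
    have "norm (fps_nth (log_fps Q) n) \<le> norm (fps_nth Q n)"
      by (cases n) (auto simp: log_fps_def norm_divide divide_le_eq mult_le_cancel_left1 simp del: of_nat_Suc)
    then show "norm (fps_nth (log_fps Q) n * of_real r ^ n) \<le> norm (fps_nth Q n * of_real r ^ n)"
      by (simp add: norm_mult mult_right_mono)
  qed
qed

definition words_meeting :: "('a \<times> 'a) set \<Rightarrow> 'a set \<Rightarrow> 'a list set" where
  "words_meeting E F = {ws. cyc E ws \<and> set ws \<inter> F \<noteq> {}}"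

definition log_zeta_fps :: "('a \<times> 'a) set \<Rightarrow> 'a set \<Rightarrow> complex fps" where
  "log_zeta_fps E F = log_fps (counting_fps (words_meeting E F) length)"

lemma eball_less: "z \<in> eball 0 R \<Longrightarrow> R \<le> R' \<Longrightarrow> ereal (norm z) < R'"
  by (auto simp: eball_def intro: less_le_trans)

lemma holomorphic_exp_eval_fps:
  fixes f :: "complex fps"
  assumes "R \<le> fps_conv_radius f"
  shows "(\<lambda>z. exp (eval_fps f z)) holomorphic_on eball 0 R"
proof -
  have "eball 0 R \<subseteq> eball 0 (fps_conv_radius f)"
    using assms by (auto simp: eball_def intro: less_le_trans)
  then have "eval_fps f holomorphic_on eball 0 R"
    by (rule FPS_Convergence.holomorphic_on_eval_fps)
  then have "exp \<circ> eval_fps f holomorphic_on eball 0 R"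
    by (rule holomorphic_on_compose) (rule holomorphic_on_exp)
  then show ?thesis by (simp add: o_def)
qed

lemma convex_eball: "convex (eball (0 :: complex) R)"
  by (cases R) auto

context finite_walks
begin

lemma words_meeting_insert:
  "words_meeting E (insert a F) = words_meeting E F \<union> cyc_words E F a"
  "words_meeting E F \<inter> cyc_words E F a = {}"
  by (auto simp: words_meeting_def cyc_words_def)

text \<open>There may be infinitely many cyclic words of a given length in all, but adding a vertex
  to \<open>F\<close> adds only words through that vertex, and these have finite levels.\<close>

lemma finite_levels_words_meeting: "finite F \<Longrightarrow> finite_levels (words_meeting E F) length"
proof (induction F rule: finite_induct)
  case empty
  then show ?case by (simp add: words_meeting_def finite_levels_def)
next
  case (insert a F)
  then show ?case
    using counting_fps_cyc_words(2)[of a F] unfolding words_meeting_insert(1) finite_levels_def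
    by (simp add: Collect_disj_eq conj_disj_distribR)
qed

lemma log_zeta_fps_insert:
  assumes "finite F" "a \<notin> F"
  shows "log_zeta_fps E (insert a F) = log_zeta_fps E F + log_fps (counting_fps (cyc_words E F a) length)"
  unfolding log_zeta_fps_def words_meeting_insert(1)
  using assms finite_levels_words_meeting[of F] counting_fps_cyc_words(2)[of a F]
  by (subst counting_fps_Un) (simp_all add: words_meeting_insert(2) log_fps_add)

text \<open>Here the division-free form of the logarithmic derivative pays off: sums, products,
  derivatives and \<open>log_fps\<close> do not lower the common bound \<open>R\<close> on the
  radii.\<close>

lemma conv_radius_cyc_words:
  assumes "a \<notin> S" and "R \<le> fps_conv_radius (walk_fps E S a a)"
    and "R \<le> fps_conv_radius (walk_fps E (insert a S) a a)"
  shows "R \<le> fps_conv_radius (log_fps (counting_fps (cyc_words E S a) length))"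
proof -
  let ?P = "walk_fps E (insert a S) a a" and ?W = "walk_fps E S a a"
  have "R \<le> fps_conv_radius (fps_deriv ?P)"
    using assms(3) fps_conv_radius_deriv by (rule order_trans)
  then have "R \<le> fps_conv_radius (fps_X * fps_deriv ?P)"
    by (intro order_trans[OF _ fps_conv_radius_mult]) simp
  moreover have "R \<le> fps_conv_radius (1 + ?W)"
    using assms(2) by (intro order_trans[OF _ fps_conv_radius_add]) simp
  ultimately have "R \<le> fps_conv_radius (counting_fps (cyc_words E S a) length)"
    unfolding counting_fps_cyc_words(1)[OF assms(1)] by (intro order_trans[OF _ fps_conv_radius_mult]) simp
  then show ?thesis using fps_conv_radius_log_fps by (rule order_trans)
qed

text \<open>The difference telescopes over the vertices of \<open>X\<close>, and every intermediate
  set still contains \<open>S\<^sub>0\<close>. With \<open>F\<close> and \<open>S\<^sub>0\<close>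
  empty this also bounds the radius of \<open>log_zeta_fps\<close> itself.\<close>

lemma conv_radius_log_zeta_diff:
  assumes R: "\<And>S c d. S\<^sub>0 \<subseteq> S \<Longrightarrow> finite S \<Longrightarrow> R \<le> fps_conv_radius (walk_fps E S c d)"
    and "S\<^sub>0 \<subseteq> F" "finite F" "finite X"
  shows "R \<le> fps_conv_radius (log_zeta_fps E (F \<union> X) - log_zeta_fps E F)"
  using \<open>finite X\<close>
proof (induction X rule: finite_induct)
  case (insert a X)
  show ?case
  proof (cases "a \<in> F")
    case True
    then show ?thesis using insert.IH by (simp add: insert_absorb)
  next
    case False
    then have a: "a \<notin> F \<union> X" using insert.hyps by simp
    have "R \<le> fps_conv_radius (log_fps (counting_fps (cyc_words E (F \<union> X) a) length))"
      using assms(2,3) insert.hyps a by (intro conv_radius_cyc_words R) auto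
    with insert.IH have "R \<le> fps_conv_radius ((log_zeta_fps E (F \<union> X) - log_zeta_fps E F) +
        log_fps (counting_fps (cyc_words E (F \<union> X) a) length))"
      by (intro order_trans[OF _ fps_conv_radius_add]) simp
    also have "(log_zeta_fps E (F \<union> X) - log_zeta_fps E F) + log_fps (counting_fps (cyc_words E (F \<union> X) a) length) =
        log_zeta_fps E (F \<union> insert a X) - log_zeta_fps E F"
      using log_zeta_fps_insert[OF _ a] assms(3) insert.hyps by simp
    finally show ?thesis .
  qed
qed simp

end

text \<open>A common disc for all walk series, whatever \<open>S\<close>, on which the formal
  identities become identities between functions.\<close>

locale radius_walks = finite_walks +
  fixes R\<^sub>0 :: ereal
  assumes R\<^sub>0: "R\<^sub>0 > 0" and radius: "R\<^sub>0 \<le> fps_conv_radius (walk_fps E S c d)"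
begin

lemma eventually_eball: "eventually (\<lambda>z. z \<in> eball 0 R\<^sub>0) (at (0 :: complex))"
proof -
  have "(0 :: complex) \<in> eball 0 R\<^sub>0" using R\<^sub>0 by (simp add: eball_def zero_ereal_def)
  then show ?thesis by (rule eventually_at_in_open'[OF open_eball])
qed

lemma less_radius: "z \<in> eball 0 R\<^sub>0 \<Longrightarrow> ereal (norm z) < fps_conv_radius (walk_fps E S c d)"
  using radius[of S c d] by (auto simp: eball_def intro: less_le_trans)

lemma eval_first_visit:
  assumes "a \<notin> S" "z \<in> eball 0 R\<^sub>0"
  shows "eval_fps (walk_fps E S c d) z = eval_fps (walk_fps E (insert a S) c d) z +
    eval_fps (walk_fps E (insert a S) c a) z * eval_fps (walk_fps E S a d) z"
proof -
  have "ereal (norm z) < fps_conv_radius (walk_fps E (insert a S) c a * walk_fps E S a d)"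
    using less_radius[OF assms(2)] by (intro less_le_trans[OF _ fps_conv_radius_mult]) simp
  then show ?thesis
    using less_radius[OF assms(2)]
    by (subst walk_fps_first_visit[OF assms(1)]) (simp add: eval_fps_add eval_fps_mult)
qed

text \<open>The renewal equation at \<open>a\<close>. In particular 1 - P has no zero on the small
  disc, so the zeros that produce poles lie outside it.\<close>

lemma eval_first_return:
  assumes "a \<notin> S" "z \<in> eball 0 R\<^sub>0"
  shows "(1 - eval_fps (walk_fps E (insert a S) a a) z) * (1 + eval_fps (walk_fps E S a a) z) = 1"
  using eval_first_visit[OF assms, of a a] by (simp add: algebra_simps)

text \<open>Induction on the number of vertices of \<open>S\<^sub>0\<close> missing from
  \<open>S\<close>. If none is missing, the series itself converges on the large disc. Otherwise the
  first-visit equations for a missing vertex \<open>a\<close> are solved for the series at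
  \<open>S\<close>; the division by 1 - P costs holomorphy but not meromorphy.\<close>

lemma germ_extends_walk_fps:
  assumes R: "\<And>S c d. S\<^sub>0 \<subseteq> S \<Longrightarrow> finite S \<Longrightarrow> R \<le> fps_conv_radius (walk_fps E S c d)"
    and "finite S\<^sub>0" "finite S"
  shows "germ_extends R (eval_fps (walk_fps E S c d))"
  using \<open>finite S\<close>
proof (induction "card (S\<^sub>0 - S)" arbitrary: S c d)
  case 0
  then have "S\<^sub>0 \<subseteq> S" using assms(2) by simp
  then have "eball 0 R \<subseteq> eball 0 (fps_conv_radius (walk_fps E S c d))"
    using R[of S c d] 0 by (auto simp: eball_def intro: less_le_trans)
  then show ?case
    by (intro germ_extends_meromorphic analytic_on_imp_meromorphic_on FPS_Convergence.analytic_on_eval_fps)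
next
  case (Suc n)
  then obtain a where a: "a \<in> S\<^sub>0" "a \<notin> S"
    by (metis DiffE card.empty ex_in_conv nat.distinct(1))
  have "S\<^sub>0 - insert a S = (S\<^sub>0 - S) - {a}" by auto
  then have "n = card (S\<^sub>0 - insert a S)"
    using Suc.hyps(2) a assms(2) by (simp add: card_Diff_singleton)
  then have IH: "germ_extends R (eval_fps (walk_fps E (insert a S) c d))" for c d
    using Suc.hyps(1) Suc.prems by simp
  let ?P = "\<lambda>c d. eval_fps (walk_fps E (insert a S) c d)"
  have one: "germ_extends R (\<lambda>_. 1)"
    by (intro germ_extends_meromorphic meromorphic_on_const)
  have "germ_extends R (\<lambda>z. ?P c d z + ?P c a z * (?P a d z / (1 - ?P a a z)))"
    by (intro germ_extends_add germ_extends_mult germ_extends_divide germ_extends_diff IH one)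
  moreover have "eventually (\<lambda>z. ?P c d z + ?P c a z * (?P a d z / (1 - ?P a a z)) =
      eval_fps (walk_fps E S c d) z) (at 0)"
    using eventually_eball
  proof eventually_elim
    case (elim z)
    have "1 - ?P a a z \<noteq> 0" using eval_first_return[OF a(2) elim] by auto
    moreover have "(1 - ?P a a z) * eval_fps (walk_fps E S a d) z = ?P a d z"
      using eval_first_visit[OF a(2) elim, of a d] by (simp add: algebra_simps)
    ultimately have "?P a d z / (1 - ?P a a z) = eval_fps (walk_fps E S a d) z"
      by (metis nonzero_mult_div_cancel_left)
    then show ?case
      using eval_first_visit[OF a(2) elim, of c d] by simp
  qed
  ultimately show ?case by (rule germ_extends_cong)
qed

text \<open>The series inside the exponential is -log(1 - P) without a choice of branch: its
  derivative is P'(1 + W) = P'/(1 - P), so its exponential times 1 - P is constant, with value 1 at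
  0.\<close>

lemma exp_log_cyc_words:
  assumes a: "a \<notin> S" and z: "z \<in> eball 0 R\<^sub>0"
  shows "exp (eval_fps (log_fps (counting_fps (cyc_words E S a) length)) z) = 1 + eval_fps (walk_fps E S a a) z"
proof -
  let ?P = "walk_fps E (insert a S) a a" and ?W = "walk_fps E S a a"
  let ?T = "log_fps (counting_fps (cyc_words E S a) length)"
  define h where "h z = exp (eval_fps ?T z) * (1 - eval_fps ?P z)" for z
  have T: "fps_deriv ?T = fps_deriv ?P * (1 + ?W)"
    by (rule fps_deriv_log_fps) (simp add: counting_fps_cyc_words(1)[OF a] mult.assoc)
  have "R\<^sub>0 \<le> fps_conv_radius ?T"
    by (rule conv_radius_cyc_words[OF a radius radius])
  have "(h has_field_derivative 0) (at z within eball 0 R\<^sub>0)" if z: "z \<in> eball 0 R\<^sub>0" for z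
  proof -
    have rT: "ereal (norm z) < fps_conv_radius ?T"
      using z \<open>R\<^sub>0 \<le> fps_conv_radius ?T\<close> by (auto simp: eball_def intro: less_le_trans)
    have rD: "ereal (norm z) < fps_conv_radius (fps_deriv ?P)"
      using less_radius[OF z] fps_conv_radius_deriv by (rule less_le_trans)
    have rW: "ereal (norm z) < fps_conv_radius (1 + ?W)"
      using less_radius[OF z] by (intro less_le_trans[OF _ fps_conv_radius_add]) simp
    have T': "eval_fps (fps_deriv ?T) z = eval_fps (fps_deriv ?P) z * (1 + eval_fps ?W z)"
      unfolding T using rD rW less_radius[OF z] by (simp add: eval_fps_mult eval_fps_add)
    have "(h has_field_derivative
        exp (eval_fps ?T z) * eval_fps (fps_deriv ?T) z * (1 - eval_fps ?P z) +
        exp (eval_fps ?T z) * (0 - eval_fps (fps_deriv ?P) z)) (at z within eball 0 R\<^sub>0)"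
      unfolding h_def using rT less_radius[OF z]
      by (auto intro!: derivative_eq_intros has_field_derivative_eval_fps simp: algebra_simps)
    moreover have "eval_fps (fps_deriv ?T) z * (1 - eval_fps ?P z) = eval_fps (fps_deriv ?P) z"
      using eval_first_return[OF a z] unfolding T' by (simp add: mult.assoc mult.commute[of "1 + _"])
    ultimately show ?thesis by (simp add: mult.assoc)
  qed
  then obtain C where C: "h z = C" if "z \<in> eball 0 R\<^sub>0" for z
    using has_field_derivative_zero_constant[OF convex_eball, of R\<^sub>0 h] by blast
  have "h 0 = 1"
    by (simp add: h_def eval_fps_at_0 log_fps_def)
  then have "h z = 1"
    using C[OF z] C[of 0] R\<^sub>0 by (simp add: eball_def zero_ereal_def)
  then have "exp (eval_fps ?T z) * ((1 - eval_fps ?P z) * (1 + eval_fps ?W z)) = 1 + eval_fps ?W z"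
    by (simp add: h_def mult.assoc[symmetric])
  then show ?thesis by (simp add: eval_first_return[OF a z])
qed

lemma radius_log_zeta: "finite F \<Longrightarrow> R\<^sub>0 \<le> fps_conv_radius (log_zeta_fps E F)"
  using conv_radius_log_zeta_diff[of "{}" R\<^sub>0 "{}" F] radius
  by (simp add: log_zeta_fps_def words_meeting_def counting_fps_def log_fps_def fps_zero_def[symmetric])

lemma exp_log_zeta_insert:
  assumes "finite F" "a \<notin> F" "z \<in> eball 0 R\<^sub>0"
  shows "exp (eval_fps (log_zeta_fps E (insert a F)) z) =
    exp (eval_fps (log_zeta_fps E F) z) * (1 + eval_fps (walk_fps E F a a) z)"
proof -
  have "ereal (norm z) < fps_conv_radius (log_zeta_fps E F)"
    using assms(3) radius_log_zeta[OF assms(1)] by (auto simp: eball_def intro: less_le_trans)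
  moreover have "ereal (norm z) < fps_conv_radius (log_fps (counting_fps (cyc_words E F a) length))"
    using assms(3) conv_radius_cyc_words[OF assms(2) radius radius]
    by (auto simp: eball_def intro: less_le_trans)
  ultimately show ?thesis
    using assms by (simp add: log_zeta_fps_insert eval_fps_add exp_add exp_log_cyc_words)
qed

text \<open>The zeta function is a finite product of factors 1 + W, one for each vertex of
  \<open>F\<close>, starting from the value 1 for the empty set.\<close>

lemma germ_extends_zeta:
  assumes R: "\<And>S c d. S\<^sub>0 \<subseteq> S \<Longrightarrow> finite S \<Longrightarrow> R \<le> fps_conv_radius (walk_fps E S c d)"
    and "finite S\<^sub>0" "finite F"
  shows "germ_extends R (\<lambda>z. exp (eval_fps (log_zeta_fps E F) z))"
  using \<open>finite F\<close>
proof (induction F rule: finite_induct)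
  case empty
  have "log_zeta_fps E {} = 0"
    by (simp add: log_zeta_fps_def words_meeting_def counting_fps_def log_fps_def fps_zero_def[symmetric])
  then show ?case
    by (simp add: germ_extends_meromorphic[OF meromorphic_on_const])
next
  case (insert a F)
  have "germ_extends R (\<lambda>z. exp (eval_fps (log_zeta_fps E F) z) * (1 + eval_fps (walk_fps E F a a) z))"
    by (intro germ_extends_mult germ_extends_add insert.IH germ_extends_walk_fps[OF R assms(2)]
        germ_extends_meromorphic meromorphic_on_const insert.hyps)
  moreover have "eventually (\<lambda>z. exp (eval_fps (log_zeta_fps E F) z) * (1 + eval_fps (walk_fps E F a a) z) =
      exp (eval_fps (log_zeta_fps E (insert a F)) z)) (at 0)"
    using eventually_eball by eventually_elim (simp add: exp_log_zeta_insert insert.hyps)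
  ultimately show ?case by (rule germ_extends_cong)
qed

end


section \<open>Entropy bounds on walk counts\<close>

text \<open>Comparison with a geometric series. The shift \<open>q\<close>, which will come from the
  return path, affects only a constant factor.\<close>

lemma (in finite_walks) conv_radius_walk_fps_ge:
  assumes "eventually (\<lambda>m. real (card {xs \<in> walks E S c d. length xs = m}) \<le> exp (H * (real m + q))) sequentially"
  shows "ereal (exp (- H)) \<le> fps_conv_radius (walk_fps E S c d)"
  unfolding fps_conv_radius_def
proof (rule conv_radius_geI_ex')
  fix r :: real assume r: "0 < r" "ereal r < ereal (exp (- H))"
  have "exp H * r < exp H * exp (- H)" using r by (intro mult_strict_left_mono) auto
  then have "norm (exp H * r) < 1" using r by (simp add: exp_minus abs_mult)
  then have "summable (\<lambda>m. exp (H * q) * r * (exp H * r) ^ m)"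
    by (intro summable_mult summable_geometric)
  then have "summable (\<lambda>m. fps_nth (walk_fps E S c d) (Suc m) * of_real r ^ Suc m)"
  proof (rule summable_comparison_test_ev[rotated])
    show "eventually (\<lambda>m. norm (fps_nth (walk_fps E S c d) (Suc m) * of_real r ^ Suc m) \<le>
        exp (H * q) * r * (exp H * r) ^ m) sequentially"
      using assms
    proof eventually_elim
      case (elim m)
      have "norm (fps_nth (walk_fps E S c d) (Suc m) * of_real r ^ Suc m) =
          real (card {xs \<in> walks E S c d. length xs = m}) * r ^ Suc m"
        using r by (simp add: walk_fps_nth_Suc norm_mult norm_power)
      also have "\<dots> \<le> exp (H * (real m + q)) * r ^ Suc m"
        using elim r by (intro mult_right_mono) auto
      also have "\<dots> = exp (H * q) * r * (exp H * r) ^ m"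
        by (simp add: power_mult_distrib exp_of_nat_mult[symmetric] exp_add[symmetric] algebra_simps)
      finally show ?case .
    qed
  qed
  then show "summable (\<lambda>n. fps_nth (walk_fps E S c d) n * of_real r ^ n)"
    by (subst (asm) summable_Suc_iff)
qed

section \<open>Strongly connected graphs of finite entropy\<close>

lemma reachable_imp_chain:
  assumes "u \<rightarrow>\<^sup>*\<^bsub>with_proj G\<^esub> v"
  shows "u = v \<or> (\<exists>ys. chain (parcs G) u ys v)"
  using reachable_rtranclI[OF assms]
proof (induction rule: converse_rtrancl_induct)
  case (step x y)
  have "(x, y) \<in> parcs G" using step.hyps(1) by (auto simp: arcs_ends_conv)
  then have "chain (parcs G) x [] y" "chain (parcs G) x (y # ys) v \<longleftrightarrow> chain (parcs G) y ys v" for ys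
    by auto
  then show ?case using step.IH by blast
qed simp

locale finite_entropy_graph =
  fixes G :: "'a pair_pre_digraph" and h :: real
  assumes wf: "pair_wf_digraph G"
    and strong: "strongly_connected (with_proj G)"
    and entropy: "gurevich_entropy G = ereal h"
begin

sublocale pair_wf_digraph G by (rule wf)

lemma chain_verts: "chain (parcs G) c xs d \<Longrightarrow> c \<in> pverts G \<and> d \<in> pverts G"
  by (induction xs arbitrary: c) (auto dest: in_arcsD1 in_arcsD2)

text \<open>A chain has at least one arc, whereas reachability of a vertex from itself is trivial.
  So for c = d the given chain serves as its own return.\<close>

lemma return_chain:
  assumes "chain (parcs G) c xs d"
  shows "\<exists>ys. chain (parcs G) d ys c"
proof (cases "c = d")
  case False
  have "c \<in> pverts G" "d \<in> pverts G"
    using chain_verts[OF assms] by auto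
  then have "d \<rightarrow>\<^sup>*\<^bsub>with_proj G\<^esub> c" using strong by (simp add: strongly_connected_def)
  from reachable_imp_chain[OF this] show ?thesis using False by auto
qed (use assms in auto)

text \<open>The loops are \<open>c # xs @ d # ys\<close> with \<open>ys\<close> fixed; their length
  is m + \<open>length ys + 2\<close>, and the last summand counts the places that may meet
  \<open>S\<close>. The set \<open>X\<close> is an arbitrary finite set of walks because finiteness
  of all of them is yet to be deduced from this lemma.\<close>

lemma walks_entropy:
  assumes ys: "chain (parcs G) d ys c"
    and X: "X \<subseteq> {xs \<in> walks (parcs G) S c d. length xs = m}" "finite X" "X \<noteq> {}"
  shows "\<exists>\<mu>\<in>invariant_measures G.
    ereal (ln (real (card X)) / (real m + real (length ys + 2))) \<le> ks_entropy \<mu> left_shift \<and>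
    (\<forall>F\<subseteq>S. measure \<mu> {x \<in> markov_shift G. x 0 \<in> F} \<le>
      real (length ys + 2) / (real m + real (length ys + 2)))"
proof -
  define n where "n = m + (length ys + 2)"
  define f where "f xs = c # xs @ d # ys" for xs
  have len: "length (f xs) = n" if "xs \<in> X" for xs
    using that X by (auto simp: f_def n_def)
  have arc: "(f xs ! i, f xs ! (Suc i mod n)) \<in> parcs G" if "xs \<in> X" "i < n" for xs i
  proof -
    have "cyc (parcs G) (f xs)"
      using that(1) X ys by (auto simp: f_def cyc_Cons chain_append walks_def)
    then show ?thesis
      using cyc_nth[of "f xs" "parcs G"] len[OF that(1)] that(2) by (auto simp: f_def)
  qed
  interpret L: concatenated_loops G "f ` X" n c
  proof
    show "(w ! i, w ! Suc i) \<in> parcs G" if "w \<in> f ` X" "Suc i < n" for w i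
      using that arc[of _ i] by auto
    show "(w ! (n - 1), c) \<in> parcs G" if "w \<in> f ` X" for w
      using that arc[of _ "n - 1"] by (auto simp: n_def f_def)
  qed (use X len wf in \<open>auto simp: n_def f_def\<close>)
  have n: "real n = real m + real (length ys + 2)" by (simp add: n_def)
  have inj: "inj_on f X" by (auto simp: inj_on_def f_def)
  have "ereal (ln (real (card X)) / (real m + real (length ys + 2))) \<le> ks_entropy L.loop_measure left_shift"
    using L.ks_entropy_loop_measure unfolding card_image[OF inj] n .
  moreover have "measure L.loop_measure {x \<in> markov_shift G. x 0 \<in> F} \<le>
      real (length ys + 2) / (real m + real (length ys + 2))" if F: "F \<subseteq> S" for F
  proof -
    \<comment> \<open>Position 0 holds \<open>c\<close>, positions from m + 1 on hold
      \<open>d # ys\<close>; between them lies the walk avoiding \<open>S\<close>.\<close>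
    let ?I = "insert 0 {m + 1..<n}"
    have "measure L.loop_measure {x \<in> markov_shift G. x 0 \<in> F} \<le> real (card ?I) / real n"
    proof (rule L.measure_loop_measure_le)
      fix w i assume w: "w \<in> f ` X" "i < n" "w ! i \<in> F"
      then obtain xs where xs: "xs \<in> X" "w = f xs" by auto
      show "i \<in> ?I"
      proof (rule ccontr)
        assume "i \<notin> ?I"
        then obtain j where j: "i = Suc j" "j < m" using w(2) by (cases i) auto
        then have "w ! i \<in> set xs"
          using xs X by (auto simp: f_def nth_append)
        then show False using w(3) F xs(1) X by (auto simp: walks_def)
      qed
    qed simp
    also have "real (card ?I) / real n = real (length ys + 2) / (real m + real (length ys + 2))"
      by (simp add: n_def)
    finally show ?thesis .
  qed
  ultimately show ?thesis using L.loop_measure_invariant by blast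
qed

lemma card_walks_le:
  assumes ys: "chain (parcs G) d ys c"
    and X: "X \<subseteq> {xs \<in> walks (parcs G) S c d. length xs = m}" "finite X"
  shows "real (card X) \<le> exp (h * (real m + real (length ys + 2)))"
proof (cases "X = {}")
  case False
  obtain \<mu> where \<mu>: "\<mu> \<in> invariant_measures G"
      "ereal (ln (real (card X)) / (real m + real (length ys + 2))) \<le> ks_entropy \<mu> left_shift"
    using walks_entropy[OF ys X False] by blast
  have "ks_entropy \<mu> left_shift \<le> ereal h"
    using \<mu>(1) unfolding entropy[symmetric] gurevich_entropy_def by (rule SUP_upper)
  with \<mu>(2) have "ln (real (card X)) / (real m + real (length ys + 2)) \<le> h"
    by (metis ereal_less_eq(3) order_trans)
  then have "ln (real (card X)) \<le> h * (real m + real (length ys + 2))"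
    by (simp add: divide_le_eq)
  moreover have "real (card X) > 0" using False X(2) by (simp add: card_gt_0_iff)
  ultimately show ?thesis by (metis exp_le_cancel_iff exp_ln)
qed simp

text \<open>Infinitely many walks of one length would contain finite families larger than the bound,
  which is uniform over all finite families.\<close>

sublocale finite_walks "parcs G"
proof
  fix c d m
  show "finite {xs \<in> walks (parcs G) {} c d. length xs = m}" (is "finite ?W")
  proof (rule ccontr)
    assume inf: "infinite ?W"
    then obtain xs where "chain (parcs G) c xs d"
      by (metis (mono_tags, lifting) finite.emptyI ex_in_conv mem_Collect_eq walks_def)
    then obtain ys where ys: "chain (parcs G) d ys c" using return_chain by blast
    let ?b = "exp (h * (real m + real (length ys + 2)))"
    obtain X where X: "X \<subseteq> ?W" "finite X" "card X = nat \<lceil>?b\<rceil> + 1"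
      using infinite_arbitrarily_large[OF inf] by blast
    have "real (card X) \<le> ?b" by (rule card_walks_le[OF ys X(1,2)])
    then show False using X(3) by linarith
  qed
qed

lemma finite_walks_avoiding: "finite {xs \<in> walks (parcs G) S c d. length xs = m}"
  by (rule finite_subset[OF _ finite_walks[of c d m]]) (auto simp: walks_def)

text \<open>The ends \<open>c\<close> and \<open>d\<close> range over the whole type and need not be
  vertices of \<open>G\<close>, so a return path can be claimed only once some walk exists.\<close>

lemma no_walks_or_return:
  obtains "walks (parcs G) S c d = {}" | ys where "chain (parcs G) d ys c"
proof (cases "walks (parcs G) S c d = {}")
  case False
  then obtain xs where "chain (parcs G) c xs d" by (auto simp: walks_def)
  from return_chain[OF this] show thesis using that(2) by blast
qed (use that in blast)

lemma conv_radius_no_walks: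
  "walks (parcs G) S c d = {} \<Longrightarrow> fps_conv_radius (walk_fps (parcs G) S c d) = \<infinity>"
  by (simp add: walk_fps_def counting_fps_def fps_zero_def[symmetric])

sublocale radius_walks "parcs G" "ereal (exp (- h))"
proof
  fix S c d
  show "ereal (exp (- h)) \<le> fps_conv_radius (walk_fps (parcs G) S c d)"
  proof (cases rule: no_walks_or_return[of S c d])
    case 1
    then show ?thesis by (simp add: conv_radius_no_walks)
  next
    case (2 ys)
    show ?thesis
      by (rule conv_radius_walk_fps_ge[where q = "real (length ys + 2)"], rule always_eventually)
        (use card_walks_le[OF 2 order_refl finite_walks_avoiding] in auto)
  qed
qed simp

text \<open>Long walks avoiding \<open>S\<close>, closed up by a fixed return path, give measures of small mass on \<open>S\<close>; if
  there were too many of them, the entropy of these measures would exceed the entropy at infinity.\<close>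

lemma walks_at_infinity:
  assumes H: "entropy_at_infinity G < ereal H"
  shows "\<exists>S\<^sub>0. finite S\<^sub>0 \<and> S\<^sub>0 \<subseteq> pverts G \<and> (\<forall>S c d. S\<^sub>0 \<subseteq> S \<longrightarrow> walks (parcs G) S c d \<noteq> {} \<longrightarrow>
    (\<exists>q. eventually (\<lambda>m. real (card {xs \<in> walks (parcs G) S c d. length xs = m}) <
      exp (H * (real m + real q))) sequentially))"
proof -
  obtain F \<mu>\<^sub>0 where F: "pair_fin_digraph F" "subgraph (with_proj F) (with_proj G)" and \<mu>\<^sub>0: "\<mu>\<^sub>0 > 0"
    and less: "(SUP \<mu>\<in>{\<mu> \<in> invariant_measures G.
        measure \<mu> {x \<in> markov_shift G. x 0 \<in> pverts F} < \<mu>\<^sub>0}. ks_entropy \<mu> left_shift) < ereal H"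
    using H by (auto simp: entropy_at_infinity_def INF_less_iff)
  show ?thesis
  proof (intro exI[of _ "pverts F"] conjI allI impI)
    show "finite (pverts F)" using F(1) by (rule pair_fin_digraph.pair_finite_verts)
    show "pverts F \<subseteq> pverts G" using F(2) by (auto simp: subgraph_def)
    fix S c d assume S: "pverts F \<subseteq> S" "walks (parcs G) S c d \<noteq> {}"
    then obtain ys where ys: "chain (parcs G) d ys c"
      using no_walks_or_return by blast
    \<comment> \<open>The places of a closed loop that may meet \<open>S\<close>: the return path
      and both ends.\<close>
    define q where "q = length ys + 2"
    have "(\<lambda>m. real q / (real m + real q)) \<longlonglongrightarrow> 0"
      by real_asymp
    then have "eventually (\<lambda>m. real q / (real m + real q) < \<mu>\<^sub>0) sequentially"
      using \<mu>\<^sub>0 by (rule order_tendstoD)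
    then have "eventually (\<lambda>m. real (card {xs \<in> walks (parcs G) S c d. length xs = m}) <
      exp (H * (real m + real q))) sequentially"
    proof eventually_elim
      case (elim m)
      let ?X = "{xs \<in> walks (parcs G) S c d. length xs = m}"
      show ?case
      proof (cases "?X = {}")
        case True
        then show ?thesis unfolding True by simp
      next
        case False
        obtain \<mu> where \<mu>: "\<mu> \<in> invariant_measures G"
            "ereal (ln (real (card ?X)) / (real m + real q)) \<le> ks_entropy \<mu> left_shift"
            "measure \<mu> {x \<in> markov_shift G. x 0 \<in> pverts F} \<le> real q / (real m + real q)"
          using walks_entropy[OF ys order_refl finite_walks_avoiding False] S(1) unfolding q_def by blast
        have "ks_entropy \<mu> left_shift \<le> (SUP \<mu>\<in>{\<mu> \<in> invariant_measures G.
            measure \<mu> {x \<in> markov_shift G. x 0 \<in> pverts F} < \<mu>\<^sub>0}. ks_entropy \<mu> left_shift)"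
          using \<mu>(1,3) elim by (intro SUP_upper) auto
        then have "ereal (ln (real (card ?X)) / (real m + real q)) < ereal H"
          by (rule le_less_trans[OF order_trans[OF \<mu>(2)] less])
        then have "ln (real (card ?X)) < H * (real m + real q)"
          by (simp add: divide_less_eq q_def)
        moreover have "real (card ?X) > 0"
          using False finite_walks_avoiding by (simp add: card_gt_0_iff)
        ultimately show ?thesis by (metis exp_less_cancel_iff exp_ln)
      qed
    qed
    then show "\<exists>q. eventually (\<lambda>m. real (card {xs \<in> walks (parcs G) S c d. length xs = m}) <
      exp (H * (real m + real q))) sequentially" by blast
  qed
qed

text \<open>For finite entropy at infinity, \<epsilon> is the room above it. For the value
  \<infinity> the disc is empty. For the value -\<infinity>, a growth bound with negative exponent
  forces the integer counts below 1, hence to 0: long walks do not exist, the series are polynomials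
  and the radius is infinite.\<close>

lemma radius_at_infinity:
  assumes "\<epsilon> > 0"
  shows "\<exists>S\<^sub>0. finite S\<^sub>0 \<and> S\<^sub>0 \<subseteq> pverts G \<and> (\<forall>S c d. S\<^sub>0 \<subseteq> S \<longrightarrow>
    exp_ereal (- (entropy_at_infinity G + ereal \<epsilon>)) \<le> fps_conv_radius (walk_fps (parcs G) S c d))"
proof (cases "entropy_at_infinity G")
  case (real k)
  then obtain S\<^sub>0 where S\<^sub>0: "finite S\<^sub>0" "S\<^sub>0 \<subseteq> pverts G"
    and *: "\<And>S c d. S\<^sub>0 \<subseteq> S \<Longrightarrow> walks (parcs G) S c d \<noteq> {} \<Longrightarrow>
      \<exists>q. eventually (\<lambda>m. real (card {xs \<in> walks (parcs G) S c d. length xs = m}) <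
        exp ((k + \<epsilon>) * (real m + real q))) sequentially"
    using walks_at_infinity[of "k + \<epsilon>"] assms by auto
  have "ereal (exp (- (k + \<epsilon>))) \<le> fps_conv_radius (walk_fps (parcs G) S c d)" if S: "S\<^sub>0 \<subseteq> S" for S c d
  proof (cases "walks (parcs G) S c d = {}")
    case False
    then obtain q where "eventually (\<lambda>m. real (card {xs \<in> walks (parcs G) S c d. length xs = m}) <
        exp ((k + \<epsilon>) * (real m + real q))) sequentially"
      using *[OF S] by blast
    then show ?thesis
      by (intro conv_radius_walk_fps_ge[where q = "real q"]) (auto elim: eventually_mono)
  qed (simp add: conv_radius_no_walks)
  then show ?thesis using S\<^sub>0 by (auto simp: real exp_ereal_def)
next
  case PInf
  then show ?thesis
    by (intro exI[of _ "{}"]) (simp add: exp_ereal_def fps_conv_radius_def conv_radius_nonneg)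
next
  case MInf
  then obtain S\<^sub>0 where S\<^sub>0: "finite S\<^sub>0" "S\<^sub>0 \<subseteq> pverts G"
    and *: "\<And>S c d. S\<^sub>0 \<subseteq> S \<Longrightarrow> walks (parcs G) S c d \<noteq> {} \<Longrightarrow>
      \<exists>q. eventually (\<lambda>m. real (card {xs \<in> walks (parcs G) S c d. length xs = m}) <
        exp (- 1 * (real m + real q))) sequentially"
    using walks_at_infinity[of "- 1"] by auto
  have "fps_conv_radius (walk_fps (parcs G) S c d) = \<infinity>" if S: "S\<^sub>0 \<subseteq> S" for S c d
  proof (cases "walks (parcs G) S c d = {}")
    case False
    then obtain q where "eventually (\<lambda>m. real (card {xs \<in> walks (parcs G) S c d. length xs = m}) <
        exp (- 1 * (real m + real q))) sequentially"
      using *[OF S] by blast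
    then have "eventually (\<lambda>m. fps_nth (walk_fps (parcs G) S c d) (Suc m) = 0) sequentially"
    proof eventually_elim
      case (elim m)
      also have "exp (- 1 * (real m + real q)) \<le> 1" by simp
      finally show ?case by (simp add: walk_fps_nth_Suc)
    qed
    then have "eventually (\<lambda>n. fps_nth (walk_fps (parcs G) S c d) n = 0) sequentially"
      by (subst (asm) eventually_sequentially_Suc)
    then have "conv_radius (fps_nth (walk_fps (parcs G) S c d)) = conv_radius (\<lambda>_. 0 :: complex)"
      by (intro conv_radius_cong) (auto elim: eventually_mono)
    then show ?thesis by (simp add: fps_conv_radius_def)
  qed (simp add: conv_radius_no_walks)
  then show ?thesis using S\<^sub>0 by (auto simp: MInf)
qed

lemma semi_local_zeta:
  assumes F: "finite F" and z: "z \<in> eball 0 (ereal (exp (- h)))"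
  shows "summable (semi_local_zeta_term G F z)"
    and "semi_local_zeta G F z = exp (eval_fps (log_zeta_fps (parcs G) F) z)"
proof -
  have "semi_local_zeta_term G F z = (\<lambda>n. fps_nth (log_zeta_fps (parcs G) F) (Suc n) * z ^ Suc n)"
  proof
    fix n
    have "card (periodic_points_meeting G F (Suc n)) =
        card {ws \<in> words_meeting (parcs G) F. length ws = Suc n}"
      using bij_betw_same_card[OF bij_betw_periodic_points[OF _ wf, of "Suc n" F]]
      by (simp add: words_meeting_def conj_ac)
    then show "semi_local_zeta_term G F z n = fps_nth (log_zeta_fps (parcs G) F) (Suc n) * z ^ Suc n"
      by (simp add: semi_local_zeta_term_def log_zeta_fps_def log_fps_def counting_fps_nth)
  qed
  moreover have "(\<lambda>n. fps_nth (log_zeta_fps (parcs G) F) n * z ^ n) sums eval_fps (log_zeta_fps (parcs G) F) z"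
    using z radius_log_zeta[OF F] by (intro sums_eval_fps eball_less)
  then have "(\<lambda>n. fps_nth (log_zeta_fps (parcs G) F) (Suc n) * z ^ Suc n) sums
      eval_fps (log_zeta_fps (parcs G) F) z"
    \<comment> \<open>The constant coefficient is 0, so starting the series at period 1 loses
      nothing.\<close>
    by (subst sums_Suc_iff) (simp add: log_zeta_fps_def log_fps_def)
  ultimately have "semi_local_zeta_term G F z sums eval_fps (log_zeta_fps (parcs G) F) z"
    by (simp only:)
  then show "summable (semi_local_zeta_term G F z)"
    and "semi_local_zeta G F z = exp (eval_fps (log_zeta_fps (parcs G) F) z)"
    by (auto simp: semi_local_zeta_def sums_iff)
qed

lemma finite_periodic_points:
  assumes "finite F" "n \<ge> 1"
  shows "finite (periodic_points_meeting G F n)"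
proof -
  have "finite {ws \<in> words_meeting (parcs G) F. length ws = n}"
    using finite_levels_words_meeting[OF assms(1)] by (simp add: finite_levels_def)
  then show ?thesis
    using bij_betw_finite[OF bij_betw_periodic_points[OF _ wf, of n F]] assms(2)
    by (simp add: words_meeting_def conj_ac)
qed

text \<open>Each radius below the limit leaves room for some \<epsilon> and so has its own finite
  set \<open>S\<^sub>0\<close>; the exhaustion lemma joins the resulting continuations.\<close>

lemma germ_extends_zeta_at_infinity:
  assumes "finite F"
  shows "germ_extends (exp_ereal (- entropy_at_infinity G))
    (\<lambda>z. exp (eval_fps (log_zeta_fps (parcs G) F) z))"
proof (rule germ_extends_exhaustion)
  fix r :: real assume r: "0 < r" "ereal r < exp_ereal (- entropy_at_infinity G)"
  have "\<exists>\<epsilon>>0. ereal r \<le> exp_ereal (- (entropy_at_infinity G + ereal \<epsilon>))"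
  proof (cases "entropy_at_infinity G")
    case (real k)
    then have "r < exp (- k)" using r by (simp add: exp_ereal_def)
    then have "ln r < - k" using r by (metis exp_less_cancel_iff exp_ln)
    then show ?thesis
      \<comment> \<open>This choice makes exp(-(k + \<epsilon>)) equal to r.\<close>
      using r by (intro exI[of _ "- k - ln r"]) (simp add: real exp_ereal_def)
  qed (use r in \<open>auto simp: exp_ereal_def intro: exI[of _ 1]\<close>)
  then obtain \<epsilon> where \<epsilon>: "\<epsilon> > 0" "ereal r \<le> exp_ereal (- (entropy_at_infinity G + ereal \<epsilon>))" by blast
  obtain S\<^sub>0 where "finite S\<^sub>0" "\<And>S c d. S\<^sub>0 \<subseteq> S \<Longrightarrow> ereal r \<le> fps_conv_radius (walk_fps (parcs G) S c d)"
    using radius_at_infinity[OF \<epsilon>(1)] \<epsilon>(2) by (meson order_trans)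
  then show "germ_extends (ereal r) (\<lambda>z. exp (eval_fps (log_zeta_fps (parcs G) F) z))"
    using assms by (intro germ_extends_zeta) auto
qed

text \<open>Neither set need contain the other, so both are compared with their union. The quotient
  is then the exponential of a power series converging on the large disc, which explains the absence
  of zeros.\<close>

lemma zeta_ratio:
  assumes R: "\<And>S c d. S\<^sub>0 \<subseteq> S \<Longrightarrow> R \<le> fps_conv_radius (walk_fps (parcs G) S c d)"
    and F: "S\<^sub>0 \<subseteq> F" "finite F" and F': "S\<^sub>0 \<subseteq> F'" "finite F'"
  obtains e where "e holomorphic_on eball 0 R" "\<And>z. e z \<noteq> 0"
    "eventually (\<lambda>z. exp (eval_fps (log_zeta_fps (parcs G) F') z) /
      exp (eval_fps (log_zeta_fps (parcs G) F) z) = e z) (at 0)"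
proof
  let ?T = "log_zeta_fps (parcs G)"
  define U where "U = F \<union> F'"
  define D where "D = (?T U - ?T F) - (?T U - ?T F')"
  have "R \<le> fps_conv_radius (?T U - ?T F)"
    unfolding U_def using R F F' by (intro conv_radius_log_zeta_diff[of S\<^sub>0]) auto
  moreover have "R \<le> fps_conv_radius (?T U - ?T F')"
    unfolding U_def Un_commute[of F] using R F F' by (intro conv_radius_log_zeta_diff[of S\<^sub>0]) auto
  ultimately have "R \<le> fps_conv_radius D"
    unfolding D_def by (intro order_trans[OF _ fps_conv_radius_diff]) simp
  then show "(\<lambda>z. exp (eval_fps D z)) holomorphic_on eball 0 R"
    by (rule holomorphic_exp_eval_fps)
  show "exp (eval_fps D z) \<noteq> 0" for z by simp
  show "eventually (\<lambda>z. exp (eval_fps (?T F') z) / exp (eval_fps (?T F) z) = exp (eval_fps D z)) (at 0)"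
    using eventually_eball
  proof eventually_elim
    case (elim z)
    have "D = ?T F' - ?T F" by (simp add: D_def)
    moreover have "ereal (norm z) < fps_conv_radius (?T F)" "ereal (norm z) < fps_conv_radius (?T F')"
      by (rule eball_less[OF elim radius_log_zeta[OF F(2)]], rule eball_less[OF elim radius_log_zeta[OF F'(2)]])
    ultimately show ?case by (simp add: eval_fps_diff exp_diff)
  qed
qed

end

section \<open>Choice of the continuation and passage to the quotient\<close>

lemma exp_ereal_mono:
  assumes "\<epsilon> > 0"
  shows "exp_ereal (- (x + ereal \<epsilon>)) \<le> exp_ereal (- x)"
  using assms by (cases x) (auto simp: exp_ereal_def)

text \<open>One family \<open>Z\<close> of continuations serves both claims. Finiteness and
  summability are asserted so that \<open>card\<close> and the infinite sum mean what they should.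
  Common zeros and poles cancel in the quotient only up to its values at isolated points, hence
  \<open>remove_sings\<close>.\<close>

theorem theorem4:
  fixes G :: "'a pair_pre_digraph"
  assumes "pair_wf_digraph G"
    and "countable (pverts G)"
    and "strongly_connected (with_proj G)"
    and "\<bar>gurevich_entropy G\<bar> \<noteq> \<infinity>"
  shows "\<exists>Z :: 'a set \<Rightarrow> complex \<Rightarrow> complex.
    (\<forall>F. finite F \<and> F \<subseteq> pverts G \<longrightarrow>
       (\<forall>n\<ge>1. finite (periodic_points_meeting G F n)) \<and>
       (\<forall>z \<in> eball 0 (exp_ereal (- gurevich_entropy G)). summable (semi_local_zeta_term G F z)) \<and>
       semi_local_zeta G F holomorphic_on eball 0 (exp_ereal (- gurevich_entropy G)) \<and>
       Z F meromorphic_on eball 0 (exp_ereal (- entropy_at_infinity G)) \<and>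
       (\<forall>z \<in> eball 0 (exp_ereal (- gurevich_entropy G)). Z F z = semi_local_zeta G F z)) \<and>
    (\<forall>\<epsilon>::real. \<epsilon> > 0 \<longrightarrow>
       (\<exists>F\<^sub>0. finite F\<^sub>0 \<and> F\<^sub>0 \<subseteq> pverts G \<and>
          (\<forall>F F'. finite F \<and> F\<^sub>0 \<subseteq> F \<and> F \<subseteq> pverts G \<and>
                  finite F' \<and> F\<^sub>0 \<subseteq> F' \<and> F' \<subseteq> pverts G \<longrightarrow>
             remove_sings (\<lambda>z. Z F' z / Z F z) holomorphic_on
               eball 0 (exp_ereal (- (entropy_at_infinity G + ereal \<epsilon>))) \<and>
             (\<forall>z \<in> eball 0 (exp_ereal (- (entropy_at_infinity G + ereal \<epsilon>))).
                remove_sings (\<lambda>z. Z F' z / Z F z) z \<noteq> 0))))"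
proof -
  obtain h where h: "gurevich_entropy G = ereal h" using assms(4) by auto
  interpret finite_entropy_graph G h
    by (intro finite_entropy_graph.intro assms h)
  let ?\<zeta> = "\<lambda>F z. exp (eval_fps (log_zeta_fps (parcs G) F) z)"
  have R: "exp_ereal (- gurevich_entropy G) = ereal (exp (- h))"
    by (simp add: h exp_ereal_def)
  define D where "D = eball (0 :: complex) (ereal (exp (- h)))"
  define D' where "D' = eball (0 :: complex) (exp_ereal (- entropy_at_infinity G))"
  have "open D" "open D'" "0 \<in> D" by (auto simp: D_def D'_def)
  have "\<exists>g. g meromorphic_on D' \<and> eventually (\<lambda>z. g z = ?\<zeta> F z) (at 0)" if "finite F" for F
    using germ_extends_zeta_at_infinity[OF that] by (simp add: germ_extends_def D'_def)
  then obtain g where g: "g F meromorphic_on D'" "eventually (\<lambda>z. g F z = ?\<zeta> F z) (at 0)"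
    if "finite F" for F by metis
  \<comment> \<open>On \<open>D\<close> the value is the zeta function itself, as the claimed
    equality there requires; on the overlap with \<open>D'\<close> it coincides with the
    continuation, as is shown next.\<close>
  define Z where "Z F z = (if z \<in> D then ?\<zeta> F z else remove_sings (g F) z)" for F z
  have hol: "?\<zeta> F holomorphic_on D" if "finite F" for F
    using radius_log_zeta[OF that] unfolding D_def by (rule holomorphic_exp_eval_fps)
  have Z: "Z F z = remove_sings (g F) z" if F: "finite F" and z: "z \<in> D'" for F z
  proof (cases "z \<in> D")
    case True
    \<comment> \<open>This disc is the overlap of \<open>D\<close> and \<open>D'\<close>. The radius
      of \<open>D'\<close> may be 0, so membership of 0 is drawn from \<open>z\<close>.\<close>
    define A where "A = eball (0 :: complex) (min (ereal (exp (- h))) (exp_ereal (- entropy_at_infinity G)))"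
    have A: "A \<subseteq> D" "A \<subseteq> D'" "z \<in> A" "0 \<in> A"
      using True z by (auto simp: A_def D_def D'_def eball_def intro: le_less_trans[of _ "ereal (norm z)"])
    have an: "?\<zeta> F analytic_on D"
      using hol[OF F] \<open>open D\<close> by (simp add: analytic_on_open)
    have "eventually (\<lambda>w. g F w = ?\<zeta> F w) (at z)"
    proof (rule meromorphic_eq_continuation[OF _ _ _ _ A(4) g(2)[OF F] A(3)])
      show "g F meromorphic_on A" using g(1)[OF F] A(2) by (rule meromorphic_on_subset)
      show "?\<zeta> F meromorphic_on A"
        using analytic_on_imp_meromorphic_on[OF an] A(1) by (rule meromorphic_on_subset)
    qed (auto simp: A_def)
    then have "remove_sings (g F) z = remove_sings (?\<zeta> F) z"
      by (rule remove_sings_cong) simp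
    also have "\<dots> = ?\<zeta> F z"
      using an True by (intro remove_sings_at_analytic) (auto intro: analytic_on_subset)
    finally show ?thesis using True by (simp add: Z_def)
  qed (simp add: Z_def)
  have mero: "Z F meromorphic_on D'" if "finite F" for F
  proof -
    have "remove_sings (g F) meromorphic_on D'"
      by (intro remove_sings_meromorphic g(1) that)
    moreover have "eventually (\<lambda>w. Z F w = remove_sings (g F) w) (at z)" if "z \<in> D'" for z
      using eventually_at_in_open'[OF \<open>open D'\<close> that] by eventually_elim (simp add: Z \<open>finite F\<close>)
    ultimately show ?thesis by (subst meromorphic_on_cong) auto
  qed
  have part1: "(\<forall>n\<ge>1. finite (periodic_points_meeting G F n)) \<and>
      (\<forall>z\<in>D. summable (semi_local_zeta_term G F z)) \<and>
      semi_local_zeta G F holomorphic_on D \<and> Z F meromorphic_on D' \<and>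
      (\<forall>z\<in>D. Z F z = semi_local_zeta G F z)" if "finite F" for F
  proof -
    have "semi_local_zeta G F holomorphic_on D"
      using hol[OF that] by (rule holomorphic_transform) (simp add: semi_local_zeta(2)[OF that] D_def)
    then show ?thesis
      using finite_periodic_points[OF that] semi_local_zeta[OF that] mero[OF that]
      by (auto simp: Z_def D_def)
  qed
  have part2: "\<exists>F\<^sub>0. finite F\<^sub>0 \<and> F\<^sub>0 \<subseteq> pverts G \<and>
      (\<forall>F F'. finite F \<and> F\<^sub>0 \<subseteq> F \<and> F \<subseteq> pverts G \<and> finite F' \<and> F\<^sub>0 \<subseteq> F' \<and> F' \<subseteq> pverts G \<longrightarrow>
        remove_sings (\<lambda>z. Z F' z / Z F z) holomorphic_on
          eball 0 (exp_ereal (- (entropy_at_infinity G + ereal \<epsilon>))) \<and>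
        (\<forall>z \<in> eball 0 (exp_ereal (- (entropy_at_infinity G + ereal \<epsilon>))).
          remove_sings (\<lambda>z. Z F' z / Z F z) z \<noteq> 0))" if \<epsilon>: "\<epsilon> > 0" for \<epsilon> :: real
  proof -
    define B where "B = eball (0 :: complex) (exp_ereal (- (entropy_at_infinity G + ereal \<epsilon>)))"
    have B: "B \<subseteq> D'"
      using exp_ereal_mono[OF \<epsilon>] by (auto simp: B_def D'_def eball_def intro: less_le_trans)
    obtain S\<^sub>0 where S\<^sub>0: "finite S\<^sub>0" "S\<^sub>0 \<subseteq> pverts G"
      and rad: "\<And>S c d. S\<^sub>0 \<subseteq> S \<Longrightarrow> exp_ereal (- (entropy_at_infinity G + ereal \<epsilon>)) \<le>
        fps_conv_radius (walk_fps (parcs G) S c d)"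
      using radius_at_infinity[OF \<epsilon>] by blast
    have "remove_sings (\<lambda>z. Z F' z / Z F z) holomorphic_on B \<and>
        (\<forall>z\<in>B. remove_sings (\<lambda>z. Z F' z / Z F z) z \<noteq> 0)"
      if F: "S\<^sub>0 \<subseteq> F" "finite F" and F': "S\<^sub>0 \<subseteq> F'" "finite F'" for F F'
    proof -
      obtain e where e: "e holomorphic_on B" "\<And>z. e z \<noteq> 0"
          "eventually (\<lambda>z. ?\<zeta> F' z / ?\<zeta> F z = e z) (at 0)"
        using zeta_ratio[OF rad F F'] unfolding B_def by blast
      have an: "e analytic_on B" using e(1) by (simp add: B_def analytic_on_open)
      have "eventually (\<lambda>z. z \<in> D) (at 0)"
        using \<open>0 \<in> D\<close> by (rule eventually_at_in_open'[OF \<open>open D\<close>])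
      with e(3) have near: "eventually (\<lambda>z. Z F' z / Z F z = e z) (at 0)"
        by eventually_elim (simp add: Z_def)
      \<comment> \<open>The equality known near 0 spreads over \<open>B\<close> by the identity
        theorem; since \<open>e\<close> is analytic, \<open>remove_sings\<close> turns it into a
        pointwise one.\<close>
      have eq: "remove_sings (\<lambda>z. Z F' z / Z F z) z = e z" if z: "z \<in> B" for z
      proof -
        have "ereal 0 \<le> ereal (norm z)" by simp
        also have "ereal (norm z) < exp_ereal (- (entropy_at_infinity G + ereal \<epsilon>))"
          using z by (simp add: B_def eball_def)
        finally have "0 \<in> B" by (simp add: B_def eball_def)
        have "eventually (\<lambda>w. Z F' w / Z F w = e w) (at z)"
        proof (rule meromorphic_eq_continuation[OF _ _ _ _ \<open>0 \<in> B\<close> near z])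
          show "(\<lambda>w. Z F' w / Z F w) meromorphic_on B"
            by (intro meromorphic_on_divide meromorphic_on_subset[OF mero B] F(2) F'(2))
          show "e meromorphic_on B" using an by (rule analytic_on_imp_meromorphic_on)
        qed (auto simp: B_def)
        then have "remove_sings (\<lambda>z. Z F' z / Z F z) z = remove_sings e z"
          by (rule remove_sings_cong) simp
        also have "\<dots> = e z"
          using an z by (intro remove_sings_at_analytic) (auto intro: analytic_on_subset)
        finally show ?thesis .
      qed
      then show ?thesis using e(1,2) by (auto cong: holomorphic_cong)
    qed
    then show ?thesis
      using S\<^sub>0 unfolding B_def by (intro exI[of _ S\<^sub>0]) auto
  qed
  show ?thesis
    unfolding R D_def[symmetric] D'_def[symmetric]
  proof (rule exI[of _ Z], rule conjI, goal_cases)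
    case 1
    show ?case by (intro allI impI part1) simp
  next
    case 2
    show ?case by (intro allI impI) (rule part2)
  qed
qed

end
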